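(* Let $(G,N,\theta)$ be a character triple, let $\pi$ be a set of primes, and suppose that $\varphi$ and $\varphi'$ are normalized $\pi$-quasi extensions of $\theta$ to $G$. Then there exists a linear character $\lambda$ of $G/N$ such that $\varphi'=\lambda\varphi$ (where $\lambda$ is regarded as a character of $G$ with $N$ in its kernel).
   Context: All groups are finite. A character triple $(G,N,\theta)$ consists of a finite group $G$, a normal subgroup $N$ of $G$ and a $G$-invariant irreducible complex character $\theta\in\mathrm{Irr}(N)$. For a set of primes $\pi$, $\pi'$ is the complement of $\pi$ in the set of all primes; a $\pi'$-group is a group whose order is divisible only by primes in $\pi'$. For $x\in G$, $x_\pi$ denotes the $\pi$-part of $x$ (so $x=x_\pi x_{\pi'}=x_{\pi'}x_\pi$, where $x_\pi$ and $x_{\pi'}$ are powers of $x$ whose orders are a $\pi$-number and a $\pi'$-number, respectively). A $\pi$-quasi extension of $\theta$ to $G$ is a complex-valued class function $\tilde\theta$ of $G$ such that for each $\pi'$-subgroup $H/N$ of $G/N$, the restriction $\tilde\theta_H$ is a character of $H$ that extends $\theta$ (i.e. $(\tilde\theta_H)_N=\theta$). It is normalized if it vanishes on all elements $x\in G$ with $x_\pi\notin N$. *)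

theory Defs
  imports
    "HOL-Algebra.Multiplicative_Group"
    "HOL-Number_Theory.Cong"
    "Jordan_Normal_Form.VS_Connect"
begin

section \<open>Complex characters\<close>

text \<open>
  Characters and class functions of a group \<open>G\<close> are functions on the whole type of elements;
  only their values on \<open>carrier G\<close> matter. Hence the same function may also be read as its own
  restriction to a subgroup \<open>H\<close>, i.e. as a function on \<open>G\<lparr>carrier := H\<rparr>\<close>.
\<close>

abbreviation GL :: "nat \<Rightarrow> complex mat monoid" where
  "GL n \<equiv> units_of (ring_mat TYPE(complex) n ())"

definition representation ::
  "('a, 'b) monoid_scheme \<Rightarrow> nat \<Rightarrow> ('a \<Rightarrow> complex mat) \<Rightarrow> bool" where
  "representation G n X \<longleftrightarrow> n > 0 \<and> X \<in> hom G (GL n)"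

definition mat_trace :: "complex mat \<Rightarrow> complex" where
  "mat_trace A = (\<Sum>i<dim_row A. A $$ (i, i))"

definition affords ::
  "('a, 'b) monoid_scheme \<Rightarrow> ('a \<Rightarrow> complex mat) \<Rightarrow> ('a \<Rightarrow> complex) \<Rightarrow> bool" where
  "affords G X \<chi> \<longleftrightarrow> (\<forall>g\<in>carrier G. \<chi> g = mat_trace (X g))"

definition irreducible_representation ::
  "('a, 'b) monoid_scheme \<Rightarrow> nat \<Rightarrow> ('a \<Rightarrow> complex mat) \<Rightarrow> bool" where
  "irreducible_representation G n X \<longleftrightarrow>
     representation G n X \<and>
     (\<forall>W. VectorSpace.subspace class_ring W (module_vec TYPE(complex) n) \<longrightarrow>
          (\<forall>g\<in>carrier G. \<forall>v\<in>W. X g *\<^sub>v v \<in> W) \<longrightarrow>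
          W = {0\<^sub>v n} \<or> W = carrier_vec n)"

definition is_character :: "('a, 'b) monoid_scheme \<Rightarrow> ('a \<Rightarrow> complex) \<Rightarrow> bool" where
  "is_character G \<chi> \<longleftrightarrow> (\<exists>n X. representation G n X \<and> affords G X \<chi>)"

definition irreducible_character :: "('a, 'b) monoid_scheme \<Rightarrow> ('a \<Rightarrow> complex) \<Rightarrow> bool" where
  "irreducible_character G \<chi> \<longleftrightarrow>
     (\<exists>n X. irreducible_representation G n X \<and> affords G X \<chi>)"

text \<open>A linear character is a character of degree one; the degree is the value at the identity.\<close>

definition linear_character :: "('a, 'b) monoid_scheme \<Rightarrow> ('a \<Rightarrow> complex) \<Rightarrow> bool" where
  "linear_character G \<chi> \<longleftrightarrow> is_character G \<chi> \<and> \<chi> \<one>\<^bsub>G\<^esub> = 1"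

definition class_function :: "('a, 'b) monoid_scheme \<Rightarrow> ('a \<Rightarrow> complex) \<Rightarrow> bool" where
  "class_function G f \<longleftrightarrow>
     (\<forall>g\<in>carrier G. \<forall>x\<in>carrier G. f (g \<otimes>\<^bsub>G\<^esub> x \<otimes>\<^bsub>G\<^esub> inv\<^bsub>G\<^esub> g) = f x)"

definition character_triple ::
  "('a, 'b) monoid_scheme \<Rightarrow> 'a set \<Rightarrow> ('a \<Rightarrow> complex) \<Rightarrow> bool" where
  "character_triple G N \<theta> \<longleftrightarrow>
     finite (carrier G) \<and> N \<lhd> G \<and>
     irreducible_character (G\<lparr>carrier := N\<rparr>) \<theta> \<and>
     (\<forall>g\<in>carrier G. \<forall>x\<in>N. \<theta> (g \<otimes>\<^bsub>G\<^esub> x \<otimes>\<^bsub>G\<^esub> inv\<^bsub>G\<^esub> g) = \<theta> x)"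


section \<open>Sets of primes\<close>

definition compl_primes :: "nat set \<Rightarrow> nat set" where
  "compl_primes \<pi> = {p. prime p} - \<pi>"

definition pi_number :: "nat set \<Rightarrow> nat \<Rightarrow> bool" where
  "pi_number \<pi> n \<longleftrightarrow> n > 0 \<and> prime_factors n \<subseteq> \<pi>"

definition is_pi_part :: "('a, 'b) monoid_scheme \<Rightarrow> nat set \<Rightarrow> 'a \<Rightarrow> 'a \<Rightarrow> bool" where
  "is_pi_part G \<pi> x y \<longleftrightarrow>
     (\<exists>z (a::nat) (b::nat). y = x [^]\<^bsub>G\<^esub> a \<and> z = x [^]\<^bsub>G\<^esub> b \<and>
        x = y \<otimes>\<^bsub>G\<^esub> z \<and> x = z \<otimes>\<^bsub>G\<^esub> y \<and>
        pi_number \<pi> (group.ord G y) \<and> pi_number (compl_primes \<pi>) (group.ord G z))"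

text \<open>In a finite group the following description is proper; see \<open>ex1_pi_part\<close>.\<close>

definition pi_part :: "('a, 'b) monoid_scheme \<Rightarrow> nat set \<Rightarrow> 'a \<Rightarrow> 'a" where
  "pi_part G \<pi> x = (THE y. is_pi_part G \<pi> x y)"

lemma pi_number_coprime:
  assumes "pi_number \<pi> m" "pi_number (compl_primes \<pi>) n"
  shows "coprime m n"
proof (rule ccontr)
  assume "\<not> coprime m n"
  then have "gcd m n \<noteq> 1" by (simp add: coprime_iff_gcd_eq_1)
  then obtain p where p: "prime p" "p dvd gcd m n"
    using prime_factor_nat by blast
  then have p: "prime p" "p dvd m" "p dvd n" by auto
  then have "p \<in> prime_factors m" "p \<in> prime_factors n"
    using assms by (auto simp: pi_number_def in_prime_factors_iff)
  then show False
    using assms by (auto simp: pi_number_def compl_primes_def)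
qed

lemma pi_number_mult:
  "pi_number \<pi> m \<Longrightarrow> pi_number \<pi> n \<Longrightarrow> pi_number \<pi> (m * n)"
  by (auto simp: pi_number_def prime_factors_product)

lemma pi_number_dvd:
  "pi_number \<pi> m \<Longrightarrow> n dvd m \<Longrightarrow> pi_number \<pi> n"
  unfolding pi_number_def
  using dvd_prime_factors[of m n] by (auto intro: Nat.gr0I)

lemma pi_number_factorization:
  fixes n :: nat
  assumes "n > 0"
  obtains m k where "n = m * k" "pi_number \<pi> m" "pi_number (compl_primes \<pi>) k"
proof -
  have "\<exists>m k. n = m * k \<and> pi_number \<pi> m \<and> pi_number (compl_primes \<pi>) k"
    using assms
  proof (induction n rule: less_induct)
    case (less n)
    show ?case
    proof (cases "n = 1")
      case True
      then show ?thesis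
        by (intro exI[of _ 1]) (simp add: pi_number_def)
    next
      case False
      then obtain p where p: "prime p" "p dvd n"
        using prime_factor_nat by blast
      then obtain l where l: "n = p * l" by (auto elim: dvdE)
      with p less.prems have "l < n" "l > 0"
        by (auto simp: prime_gt_Suc_0_nat)
      with less.IH obtain m k where mk: "l = m * k" "pi_number \<pi> m" "pi_number (compl_primes \<pi>) k"
        by blast
      show ?thesis
      proof (cases "p \<in> \<pi>")
        case True
        then have "pi_number \<pi> (p * m)"
          using p mk by (intro pi_number_mult) (auto simp: pi_number_def prime_prime_factors prime_gt_0_nat)
        then show ?thesis using mk l by (metis mult.assoc)
      next
        case False
        then have "pi_number (compl_primes \<pi>) (p * k)"
          using p mk by (intro pi_number_mult)
            (auto simp: pi_number_def compl_primes_def prime_prime_factors prime_gt_0_nat)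
        then show ?thesis using mk l by (metis mult.left_commute)
      qed
    qed
  qed
  then show ?thesis using that by blast
qed

lemma (in group) nat_pow_eq_iff:
  assumes "x \<in> carrier G"
  shows "x [^] (a::nat) = x [^] (b::nat) \<longleftrightarrow> [a = b] (mod ord x)"
  using int_pow_eq[OF assms, of "int a" "int b"]
  by (simp add: int_pow_int cong_int_iff[symmetric] cong_iff_dvd_diff dvd_diff_commute)

lemma (in group) ex1_pi_part:
  assumes "finite (carrier G)" "x \<in> carrier G"
  shows "\<exists>!y. is_pi_part G \<pi> x y"
proof -
  have "ord x > 0" using assms ord_ge_1 by fastforce
  then obtain m k where mk: "ord x = m * k" "pi_number \<pi> m" "pi_number (compl_primes \<pi>) k"
    by (rule pi_number_factorization)
  have cop: "coprime m k" using mk pi_number_coprime by blast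
  obtain a where a: "[a = 1] (mod m)" "[a = 0] (mod k)"
    using binary_chinese_remainder_nat[OF cop] by blast
  obtain b where b: "[b = 0] (mod m)" "[b = 1] (mod k)"
    using binary_chinese_remainder_nat[OF cop] by blast
  have ab: "x [^] (a + b) = x"
  proof -
    have "[a + b = 1] (mod m)" "[a + b = 1] (mod k)"
      using cong_add[OF a(1) b(1)] cong_add[OF a(2) b(2)] by simp_all
    then have "[a + b = 1] (mod ord x)"
      using coprime_cong_mult_nat cop mk(1) by metis
    then have "x [^] (a + b) = x [^] (1::nat)"
      using nat_pow_eq_iff assms by blast
    then show ?thesis using assms by simp
  qed
  have "ord x dvd a * m" "ord x dvd b * k"
    using a(2) b(1) mk(1) by (auto simp: cong_0_iff mult_dvd_mono mult.commute)
  then have "(x [^] a) [^] m = \<one>" "(x [^] b) [^] k = \<one>"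
    using assms by (simp_all add: nat_pow_pow pow_eq_id)
  then have "ord (x [^] a) dvd m" "ord (x [^] b) dvd k"
    using assms by (simp_all add: pow_eq_id)
  then have ords: "pi_number \<pi> (ord (x [^] a))" "pi_number (compl_primes \<pi>) (ord (x [^] b))"
    using mk pi_number_dvd by blast+
  have "is_pi_part G \<pi> x (x [^] a)"
    unfolding is_pi_part_def
    by (rule exI[of _ "x [^] b"], rule exI[of _ a], rule exI[of _ b])
      (use ab ords assms(2) in \<open>simp add: nat_pow_mult add.commute[of b a]\<close>)
  moreover have "y = y'" if y: "is_pi_part G \<pi> x y" and y': "is_pi_part G \<pi> x y'" for y y'
  proof -
    from y obtain z and a b :: nat where 1: "y = x [^] a" "z = x [^] b" "x = y \<otimes> z"
      "pi_number \<pi> (ord y)" "pi_number (compl_primes \<pi>) (ord z)"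
      unfolding is_pi_part_def by blast
    from y' obtain z' and a' b' :: nat where 2: "y' = x [^] a'" "z' = x [^] b'" "x = y' \<otimes> z'"
      "pi_number \<pi> (ord y')" "pi_number (compl_primes \<pi>) (ord z')"
      unfolding is_pi_part_def by blast
    define M where "M = ord y * ord y'"
    define K where "K = ord z * ord z'"
    have "coprime M K"
      unfolding M_def K_def
      by (rule pi_number_coprime[of \<pi>]) (use 1(4,5) 2(4,5) in \<open>simp_all add: pi_number_mult\<close>)
    have dvd_ord: "ord x dvd c * ord (x [^] c)" for c
    proof -
      have "x [^] (c * ord (x [^] c)) = \<one>"
        using pow_ord_eq_1[of "x [^] c"] nat_pow_pow[of x c] nat_pow_closed[of x c] assms(2)
        by metis
      then show ?thesis using assms by (simp add: pow_eq_id)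
    qed
    have "ord x dvd a * M" "ord x dvd a' * M" "ord x dvd b * K" "ord x dvd b' * K"
      using dvd_mult2[OF dvd_ord[of a], of "ord y'"] dvd_mult2[OF dvd_ord[of a'], of "ord y"]
        dvd_mult2[OF dvd_ord[of b], of "ord z'"] dvd_mult2[OF dvd_ord[of b'], of "ord z"]
      unfolding M_def K_def 1(1,2) 2(1,2) by (simp_all add: mult_ac)
    then have d: "int (ord x) dvd int a * int M" "int (ord x) dvd int a' * int M"
      "int (ord x) dvd int b * int K" "int (ord x) dvd int b' * int K"
      by (simp_all only: of_nat_mult[symmetric] int_dvd_int_iff)
    have "x [^] (a + b) = x [^] (a' + b')"
      using 1(3)[symmetric] 2(3)[symmetric] assms(2) unfolding 1(1,2) 2(1,2)
      by (simp add: nat_pow_mult)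
    then have "int (ord x) dvd (int a + int b) - (int a' + int b')"
      using assms(2) by (simp add: nat_pow_eq_iff cong_int_iff[symmetric] cong_iff_dvd_diff)
    then have "int (ord x) dvd ((int a + int b) - (int a' + int b')) * int K"
      by (rule dvd_mult2)
    then have "int (ord x) dvd ((int a + int b) - (int a' + int b')) * int K
        - (int b * int K - int b' * int K)"
      using d by (intro dvd_diff) auto
    then have K: "int (ord x) dvd (int a - int a') * int K"
      by (simp add: algebra_simps)
    have M: "int (ord x) dvd (int a - int a') * int M"
      using d by (simp add: left_diff_distrib)
    have "coprime (int M) (int K)" using \<open>coprime M K\<close> by simp
    then obtain u v where uv: "u * int M + v * int K = 1"
      using bezout_int[of "int M" "int K"] by auto
    have "int (ord x) dvd u * ((int a - int a') * int M) + v * ((int a - int a') * int K)"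
      by (intro dvd_add dvd_mult[OF M] dvd_mult[OF K])
    also have "\<dots> = (int a - int a') * (u * int M + v * int K)"
      by (simp add: algebra_simps)
    finally have "int (ord x) dvd int a - int a'"
      using uv by simp
    then show ?thesis
      unfolding 1(1) 2(1) using assms(2) by (simp add: nat_pow_eq_iff cong_int_iff[symmetric] cong_iff_dvd_diff)
  qed
  ultimately show ?thesis by blast
qed


section \<open>Quasi extensions\<close>

text \<open>
  The subgroups of \<open>G Mod N\<close> are the quotients \<open>H / N\<close> for the subgroups \<open>H\<close> of \<open>G\<close> containing \<open>N\<close>.
\<close>

definition quasi_extension ::
  "('a, 'b) monoid_scheme \<Rightarrow> 'a set \<Rightarrow> ('a \<Rightarrow> complex) \<Rightarrow> nat set \<Rightarrow> ('a \<Rightarrow> complex) \<Rightarrow> bool" where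
  "quasi_extension G N \<theta> \<pi> \<phi> \<longleftrightarrow>
     class_function G \<phi> \<and>
     (\<forall>H. subgroup H G \<longrightarrow> N \<subseteq> H \<longrightarrow>
          pi_number (compl_primes \<pi>) (Coset.order (G\<lparr>carrier := H\<rparr> Mod N)) \<longrightarrow>
          is_character (G\<lparr>carrier := H\<rparr>) \<phi> \<and> (\<forall>x\<in>N. \<phi> x = \<theta> x))"

definition normalized_quasi_extension ::
  "('a, 'b) monoid_scheme \<Rightarrow> 'a set \<Rightarrow> ('a \<Rightarrow> complex) \<Rightarrow> nat set \<Rightarrow> ('a \<Rightarrow> complex) \<Rightarrow> bool" where
  "normalized_quasi_extension G N \<theta> \<pi> \<phi> \<longleftrightarrow>
     quasi_extension G N \<theta> \<pi> \<phi> \<and>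
     (\<forall>x\<in>carrier G. pi_part G \<pi> x \<notin> N \<longrightarrow> \<phi> x = 0)"

end

theory Submission
  imports Defs "Jordan_Normal_Form.Spectral_Radius" "HOL-Algebra.Sylow"
begin

text \<open>
  Two characters of \<open>H\<close> extending the same irreducible character of \<open>N\<close> are afforded by
  representations that agree on \<open>N\<close>; by Schur's lemma these differ by a scalar at each element,
  and the scalars form a linear character of \<open>H/N\<close>. Since an extension of \<open>\<theta>\<close> vanishes
  identically on no coset of \<open>N\<close>, the scalar is determined by \<open>\<phi>\<close> and \<open>\<phi>'\<close> alone. So there is one
  class function \<open>c\<close> on \<open>G/N\<close> which restricts to a linear character of every \<open>\<pi>'\<close>-subgroup.

  To extend \<open>c\<close> from the \<open>\<pi>'\<close>-elements to a linear character of the whole quotient \<open>Q = G/N\<close>, no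
  induction theorem is needed, only the transfer: for a Sylow \<open>p\<close>-subgroup \<open>P\<close> with \<open>p\<close> not in
  \<open>\<pi>\<close>, the transfer of the restriction of \<open>c\<close> to \<open>P\<close> is a linear character of \<open>Q\<close> that agrees with
  \<open>c\<close> to the power \<open>|Q : P|\<close> on all \<open>\<pi>'\<close>-elements. The indices \<open>|Q : P|\<close> together with the
  \<open>\<pi>'\<close>-part of \<open>|Q|\<close> (that power of \<open>c\<close> is trivial on \<open>\<pi>'\<close>-elements) have greatest common
  divisor \<open>1\<close>.
\<close>

section \<open>Representations and Schur orthogonality\<close>

lemma mat_trace_mult_comm:
  assumes "A \<in> carrier_mat n n" "B \<in> carrier_mat n n"
  shows "mat_trace (A * B) = mat_trace (B * A)"
proof -
  have "mat_trace (A * B) = (\<Sum>i<n. \<Sum>j<n. A $$ (i, j) * B $$ (j, i))"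
    using assms by (simp add: mat_trace_def scalar_prod_def atLeast0LessThan)
  also have "\<dots> = (\<Sum>j<n. \<Sum>i<n. B $$ (j, i) * A $$ (i, j))"
    by (subst sum.swap) (simp add: mult.commute)
  also have "\<dots> = mat_trace (B * A)"
    using assms by (simp add: mat_trace_def scalar_prod_def atLeast0LessThan)
  finally show ?thesis .
qed

lemma mat_trace_conjugate:
  assumes "A \<in> carrier_mat n n" "S \<in> carrier_mat n n" "T \<in> carrier_mat n n" "T * S = 1\<^sub>m n"
  shows "mat_trace (S * A * T) = mat_trace A"
proof -
  have "mat_trace (S * A * T) = mat_trace (T * (S * A))"
    using assms by (intro mat_trace_mult_comm[of _ n]) auto
  also have "T * (S * A) = T * S * A"
    using assms by (intro assoc_mult_mat[symmetric]) auto
  finally show ?thesis using assms by simp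
qed

lemma representation_carrier:
  assumes "representation G n X" "g \<in> carrier G"
  shows "X g \<in> carrier_mat n n"
proof -
  have "X g \<in> carrier (GL n)"
    using assms hom_carrier unfolding representation_def by blast
  then show ?thesis
    by (auto simp: units_of_def Units_def ring_mat_simps)
qed

lemma representation_mult:
  assumes "representation G n X" "g \<in> carrier G" "h \<in> carrier G"
  shows "X (g \<otimes>\<^bsub>G\<^esub> h) = X g * X h"
  using assms unfolding representation_def
  by (auto simp: hom_def units_of_def ring_mat_simps)

lemma representation_one:
  assumes "group G" "representation G n X"
  shows "X \<one>\<^bsub>G\<^esub> = 1\<^sub>m n"
proof -
  interpret R: ring "ring_mat TYPE(complex) n ()" by (rule ring_mat)
  interpret U: group "GL n" by (rule R.units_group)
  have "X \<one>\<^bsub>G\<^esub> = \<one>\<^bsub>GL n\<^esub>"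
    using assms U.is_group hom_one unfolding representation_def by blast
  then show ?thesis by (simp add: units_of_def ring_mat_simps)
qed

lemma representation_inv:
  fixes G (structure)
  assumes "group G" "representation G n X" "g \<in> carrier G"
  shows "X g * X (inv\<^bsub>G\<^esub> g) = 1\<^sub>m n" "X (inv\<^bsub>G\<^esub> g) * X g = 1\<^sub>m n"
proof -
  interpret group G by fact
  show "X g * X (inv g) = 1\<^sub>m n"
    using representation_mult[OF assms(2,3), of "inv g"] representation_one[OF assms(1,2)] assms(3)
    by simp
  show "X (inv g) * X g = 1\<^sub>m n"
    using representation_mult[OF assms(2) _ assms(3), of "inv g"] representation_one[OF assms(1,2)]
      assms(3) by simp
qed

lemma representationI:
  fixes G (structure)
  assumes G: "group G" and "n > 0"
    and X: "\<And>g. g \<in> carrier G \<Longrightarrow> X g \<in> carrier_mat n n"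
    and mult: "\<And>g h. g \<in> carrier G \<Longrightarrow> h \<in> carrier G \<Longrightarrow> X (g \<otimes>\<^bsub>G\<^esub> h) = X g * X h"
    and one: "X \<one>\<^bsub>G\<^esub> = 1\<^sub>m n"
  shows "representation G n X"
proof -
  interpret group G by fact
  have "X g \<in> carrier (GL n)" if g: "g \<in> carrier G" for g
  proof -
    have "X g * X (inv g) = 1\<^sub>m n" "X (inv g) * X g = 1\<^sub>m n"
      using mult[of g "inv g"] mult[of "inv g" g] g one by simp_all
    then show ?thesis
      using X[of g] X[of "inv g"] g
      unfolding units_of_def Units_def by (auto simp: ring_mat_simps)
  qed
  then show ?thesis
    using \<open>n > 0\<close> mult unfolding representation_def
    by (auto simp: hom_def units_of_def ring_mat_simps)
qed

section \<open>Invariant subspaces and Schur's lemma\<close>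

lemma subspace_module_vecI:
  assumes "W \<subseteq> carrier_vec n" "0\<^sub>v n \<in> W"
    and "\<And>v w. v \<in> W \<Longrightarrow> w \<in> W \<Longrightarrow> v + w \<in> W"
    and "\<And>c v. v \<in> W \<Longrightarrow> c \<cdot>\<^sub>v v \<in> W"
  shows "VectorSpace.subspace class_ring W (module_vec TYPE(complex) n)"
proof -
  interpret vec_space "TYPE(complex)" n .
  show ?thesis
    using assms by (unfold_locales) (auto simp: module_vec_simps)
qed

text \<open>An eigenspace of \<open>A\<close> is nonzero and stable under every \<open>Y g\<close>,
  so irreducibility makes it the whole space. An eigenvalue exists because the scalars are complex
  and \<open>n > 0\<close>.\<close>

lemma schur_lemma:
  assumes irr: "irreducible_representation G n Y" and A: "A \<in> carrier_mat n n"
    and comm: "\<And>g. g \<in> carrier G \<Longrightarrow> A * Y g = Y g * A"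
  shows "\<exists>c. A = c \<cdot>\<^sub>m 1\<^sub>m n"
proof -
  have rep: "representation G n Y" and "n > 0"
    using irr by (auto simp: irreducible_representation_def representation_def)
  obtain c where "eigenvalue A c"
    using spectrum_non_empty[OF A \<open>n > 0\<close>] by (auto simp: spectrum_def)
  then obtain v where v: "v \<in> carrier_vec n" "v \<noteq> 0\<^sub>v n" "A *\<^sub>v v = c \<cdot>\<^sub>v v"
    using A by (auto simp: eigenvalue_def eigenvector_def)
  define W where "W = {w \<in> carrier_vec n. A *\<^sub>v w = c \<cdot>\<^sub>v w}"
  have "VectorSpace.subspace class_ring W (module_vec TYPE(complex) n)"
    using A unfolding W_def
    by (intro subspace_module_vecI)
      (auto simp: mult_add_distrib_mat_vec smult_add_distrib_vec mult_mat_vec smult_smult_assoc mult.commute)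
  moreover have "Y g *\<^sub>v w \<in> W" if g: "g \<in> carrier G" and w: "w \<in> W" for g w
  proof -
    have Yg: "Y g \<in> carrier_mat n n" using representation_carrier[OF rep g] .
    have "A *\<^sub>v (Y g *\<^sub>v w) = (A * Y g) *\<^sub>v w"
      using Yg A w by (intro assoc_mult_mat_vec[symmetric]) (auto simp: W_def)
    also have "\<dots> = (Y g * A) *\<^sub>v w" by (simp add: comm[OF g])
    also have "\<dots> = c \<cdot>\<^sub>v (Y g *\<^sub>v w)"
      using Yg A w by (auto simp: W_def mult_mat_vec)
    finally show ?thesis using Yg w by (auto simp: W_def)
  qed
  ultimately have "W = {0\<^sub>v n} \<or> W = carrier_vec n"
    using irr unfolding irreducible_representation_def by blast
  moreover have "v \<in> W" using v by (simp add: W_def)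
  ultimately have W: "W = carrier_vec n" using v(2) by blast
  have "A = c \<cdot>\<^sub>m 1\<^sub>m n"
  proof (rule eq_matI)
    fix i j assume "i < dim_row (c \<cdot>\<^sub>m 1\<^sub>m n)" "j < dim_col (c \<cdot>\<^sub>m 1\<^sub>m n)"
    then have ij: "i < n" "j < n" by auto
    have unit: "unit_vec n j \<in> W" unfolding W by simp
    have "A *\<^sub>v unit_vec n j = c \<cdot>\<^sub>v unit_vec n j" using unit unfolding W_def by blast
    then have "(A *\<^sub>v unit_vec n j) $ i = (c \<cdot>\<^sub>v unit_vec n j) $ i" by simp
    then show "A $$ (i, j) = (c \<cdot>\<^sub>m 1\<^sub>m n) $$ (i, j)"
      using A ij by auto
  qed (use A in auto)
  then show ?thesis by blast
qed

text \<open>The kernel of \<open>T\<close> is stable under \<open>Y\<close> and is not the whole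
  space, hence is zero. As \<open>T\<close> is square, injectivity makes it invertible.\<close>

lemma intertwiner_invertible:
  assumes irr: "irreducible_representation G n Y" and rep: "representation G n X"
    and T: "T \<in> carrier_mat n n" "T \<noteq> 0\<^sub>m n n"
    and comm: "\<And>g. g \<in> carrier G \<Longrightarrow> X g * T = T * Y g"
  obtains S where "S \<in> carrier_mat n n" "S * T = 1\<^sub>m n" "T * S = 1\<^sub>m n"
proof -
  have repY: "representation G n Y" using irr by (simp add: irreducible_representation_def)
  define W where "W = {w \<in> carrier_vec n. T *\<^sub>v w = 0\<^sub>v n}"
  have "VectorSpace.subspace class_ring W (module_vec TYPE(complex) n)"
    using T unfolding W_def
    by (intro subspace_module_vecI) (auto simp: mult_add_distrib_mat_vec mult_mat_vec)
  moreover have "Y g *\<^sub>v w \<in> W" if g: "g \<in> carrier G" and w: "w \<in> W" for g w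
  proof -
    have Yg: "Y g \<in> carrier_mat n n" and Xg: "X g \<in> carrier_mat n n"
      using representation_carrier[OF repY g] representation_carrier[OF rep g] .
    have "T *\<^sub>v (Y g *\<^sub>v w) = (T * Y g) *\<^sub>v w"
      using Yg T w by (intro assoc_mult_mat_vec[symmetric]) (auto simp: W_def)
    also have "\<dots> = (X g * T) *\<^sub>v w" by (simp add: comm[OF g])
    also have "\<dots> = 0\<^sub>v n"
      using Xg T w by (auto simp: W_def)
    finally show ?thesis using Yg w by (auto simp: W_def)
  qed
  ultimately have "W = {0\<^sub>v n} \<or> W = carrier_vec n"
    using irr unfolding irreducible_representation_def by blast
  moreover have "W \<noteq> carrier_vec n"
  proof
    assume W: "W = carrier_vec n"
    have "T = 0\<^sub>m n n"
    proof (rule eq_matI)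
      fix i j assume "i < dim_row (0\<^sub>m n n :: complex mat)" "j < dim_col (0\<^sub>m n n :: complex mat)"
      then have ij: "i < n" "j < n" by auto
      have unit: "unit_vec n j \<in> W" unfolding W by simp
      have "T *\<^sub>v unit_vec n j = 0\<^sub>v n" using unit unfolding W_def by blast
      then have "(T *\<^sub>v unit_vec n j) $ i = 0\<^sub>v n $ i" by simp
      then show "T $$ (i, j) = 0\<^sub>m n n $$ (i, j)"
        using T ij by auto
    qed (use T in auto)
    then show False using T by simp
  qed
  ultimately have "det T \<noteq> 0"
    using det_0_iff_vec_prod_zero[OF T(1)] by (auto simp: W_def)
  then have "T \<in> Units (ring_mat TYPE(complex) n ())"
    by (rule det_non_zero_imp_unit[OF T(1)])
  then show ?thesis
    using that by (auto simp: Units_def ring_mat_simps)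
qed

section \<open>Averaged matrix units, orthogonality and equivalence of representations\<close>

text \<open>The sum of \<open>X(g) E Y(g\<inverse>)\<close> over all \<open>g\<close>, where \<open>E\<close> is the matrix unit at \<open>(j, k)\<close>.\<close>

definition mat_coeff_average ::
  "('a, 'b) monoid_scheme \<Rightarrow> nat \<Rightarrow> ('a \<Rightarrow> complex mat) \<Rightarrow> ('a \<Rightarrow> complex mat) \<Rightarrow> nat \<Rightarrow> nat \<Rightarrow> complex mat"
  where "mat_coeff_average G n X Y j k =
    mat n n (\<lambda>(i, l). \<Sum>g\<in>carrier G. X g $$ (i, j) * Y (inv\<^bsub>G\<^esub> g) $$ (k, l))"

text \<open>Replacing \<open>g\<close> by \<open>inv h \<otimes> g\<close> in the average moves the
  factor \<open>h\<close> from the left of \<open>X\<close> to the right of \<open>Y\<close>, as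
  \<open>inv (inv h \<otimes> g)\<close> is \<open>inv g \<otimes> h\<close>.\<close>

lemma mat_coeff_average_intertwines:
  fixes G (structure)
  assumes G: "group G" "finite (carrier G)"
    and X: "representation G n X" and Y: "representation G n Y"
    and jk: "j < n" "k < n" and h: "h \<in> carrier G"
  shows "X h * mat_coeff_average G n X Y j k = mat_coeff_average G n X Y j k * Y h"
proof -
  interpret group G by fact
  note cX = representation_carrier[OF X] and cY = representation_carrier[OF Y]
  have X_entry: "(\<Sum>m<n. X h $$ (i, m) * X g $$ (m, j)) = X (h \<otimes> g) $$ (i, j)"
    if "g \<in> carrier G" "i < n" for i g
    using representation_mult[OF X h that(1)] cX[OF h] cX[OF that(1)] jk that
    by (simp add: scalar_prod_def atLeast0LessThan)
  have Y_entry: "(\<Sum>m<n. Y g $$ (k, m) * Y h $$ (m, l)) = Y (g \<otimes> h) $$ (k, l)"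
    if "g \<in> carrier G" "l < n" for l g
    using representation_mult[OF Y that(1) h] cY[OF h] cY[OF that(1)] jk that
    by (simp add: scalar_prod_def atLeast0LessThan)
  show ?thesis
  proof (rule eq_matI)
    fix i l
    assume "i < dim_row (mat_coeff_average G n X Y j k * Y h)"
      "l < dim_col (mat_coeff_average G n X Y j k * Y h)"
    then have il: "i < n" "l < n"
      using cY[OF h] by (auto simp: mat_coeff_average_def)
    have "(X h * mat_coeff_average G n X Y j k) $$ (i, l)
      = (\<Sum>m<n. X h $$ (i, m) * (\<Sum>g\<in>carrier G. X g $$ (m, j) * Y (inv g) $$ (k, l)))"
      using il cX[OF h] by (simp add: mat_coeff_average_def scalar_prod_def atLeast0LessThan)
    also have "\<dots> = (\<Sum>g\<in>carrier G. (\<Sum>m<n. X h $$ (i, m) * X g $$ (m, j)) * Y (inv g) $$ (k, l))"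
      unfolding sum_distrib_left sum_distrib_right by (subst sum.swap) (simp add: mult.assoc)
    also have "\<dots> = (\<Sum>g\<in>carrier G. X (h \<otimes> g) $$ (i, j) * Y (inv g) $$ (k, l))"
      using il by (simp add: X_entry)
    also have "\<dots> = (\<Sum>g\<in>carrier G. X g $$ (i, j) * Y (inv g \<otimes> h) $$ (k, l))"
      using h by (intro sum.reindex_bij_witness[of _ "\<lambda>g. inv h \<otimes> g" "\<lambda>g. h \<otimes> g"])
        (auto simp: m_assoc[symmetric] inv_mult_group m_assoc)
    also have "\<dots> = (\<Sum>g\<in>carrier G. X g $$ (i, j) * (\<Sum>m<n. Y (inv g) $$ (k, m) * Y h $$ (m, l)))"
      using il by (simp add: Y_entry)
    also have "\<dots> = (\<Sum>m<n. (\<Sum>g\<in>carrier G. X g $$ (i, j) * Y (inv g) $$ (k, m)) * Y h $$ (m, l))"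
      unfolding sum_distrib_left sum_distrib_right by (subst sum.swap) (simp add: mult.assoc)
    also have "\<dots> = (mat_coeff_average G n X Y j k * Y h) $$ (i, l)"
      using il cY[OF h] by (simp add: mat_coeff_average_def scalar_prod_def atLeast0LessThan)
    finally show "(X h * mat_coeff_average G n X Y j k) $$ (i, l)
      = (mat_coeff_average G n X Y j k * Y h) $$ (i, l)" .
  qed (use cX[OF h] cY[OF h] in \<open>auto simp: mat_coeff_average_def\<close>)
qed

text \<open>The average of a matrix unit commutes with \<open>Y\<close>, so by Schur's lemma it is a
  scalar matrix; its trace identifies the scalar.\<close>

lemma schur_orthogonality:
  fixes G (structure)
  assumes G: "group G" "finite (carrier G)" and irr: "irreducible_representation G n Y"
    and "i < n" "j < n" "k < n" "l < n"
  shows "(\<Sum>g\<in>carrier G. Y g $$ (i, j) * Y (inv\<^bsub>G\<^esub> g) $$ (k, l))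
    = (if i = l \<and> j = k then of_nat (card (carrier G)) / of_nat n else 0)"
proof -
  interpret group G by fact
  have Y: "representation G n Y" using irr by (simp add: irreducible_representation_def)
  let ?T = "mat_coeff_average G n Y Y j k"
  have "?T * Y h = Y h * ?T" if "h \<in> carrier G" for h
    using mat_coeff_average_intertwines[OF G Y Y _ _ that] assms by simp
  then obtain c where c: "?T = c \<cdot>\<^sub>m 1\<^sub>m n"
    using schur_lemma[OF irr, of ?T] by (auto simp: mat_coeff_average_def)
  have entry: "(\<Sum>g\<in>carrier G. Y g $$ (a, j) * Y (inv g) $$ (k, b)) = (if a = b then c else 0)"
    if "a < n" "b < n" for a b
    using arg_cong[OF c, of "\<lambda>A. A $$ (a, b)"] that by (auto simp: mat_coeff_average_def)
  \<comment> \<open>This computes the trace of the average: summed over the diagonal, each group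
    element contributes the \<open>(k, j)\<close> entry of \<open>Y (inv g) * Y g\<close>, which is
    the identity matrix.\<close>
  have "of_nat n * c = (\<Sum>a<n. \<Sum>g\<in>carrier G. Y g $$ (a, j) * Y (inv g) $$ (k, a))"
    using entry by simp
  also have "\<dots> = (\<Sum>g\<in>carrier G. \<Sum>a<n. Y (inv g) $$ (k, a) * Y g $$ (a, j))"
    by (subst sum.swap) (simp add: mult.commute)
  also have "\<dots> = (\<Sum>g\<in>carrier G. (Y (inv g) * Y g) $$ (k, j))"
  proof (rule sum.cong[OF refl])
    fix g assume g: "g \<in> carrier G"
    show "(\<Sum>a<n. Y (inv g) $$ (k, a) * Y g $$ (a, j)) = (Y (inv g) * Y g) $$ (k, j)"
      using representation_carrier[OF Y g] representation_carrier[OF Y, of "inv g"] g assms(4-)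
      by (simp add: scalar_prod_def atLeast0LessThan)
  qed
  also have "\<dots> = (\<Sum>g\<in>carrier G. if j = k then 1 else 0)"
    using representation_inv(2)[OF G(1) Y] assms(4-) by (intro sum.cong) auto
  finally have "of_nat n * c = (if j = k then of_nat (card (carrier G)) else 0)" by simp
  moreover have "of_nat n \<noteq> (0::complex)" using \<open>i < n\<close> by simp
  ultimately have "c = (if j = k then of_nat (card (carrier G)) / of_nat n else 0)"
    by (auto simp: field_simps)
  then show ?thesis using entry[of i l] assms by auto
qed

lemma affords_degree:
  fixes G (structure)
  assumes "group G" "representation G n X" "affords G X \<chi>"
  shows "\<chi> \<one>\<^bsub>G\<^esub> = of_nat n"
proof -
  interpret group G by fact
  show ?thesis
    using assms representation_one[OF assms(1,2)] by (simp add: affords_def mat_trace_def)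
qed

text \<open>Some averaged matrix unit is a nonzero intertwiner: otherwise the sum of
  \<open>\<theta> g * \<theta> (inv g)\<close>, expanded through \<open>X\<close>, would be zero,
  while orthogonality for \<open>Y\<close> evaluates it as the group order.\<close>

lemma intertwiner_exists:
  fixes G (structure)
  assumes G: "group G" "finite (carrier G)"
    and irr: "irreducible_representation G n Y" and X: "representation G m X"
    and \<theta>: "affords G Y \<theta>" "affords G X \<theta>"
  obtains S T where "m = n" "S \<in> carrier_mat n n" "T \<in> carrier_mat n n" "S * T = 1\<^sub>m n" "T * S = 1\<^sub>m n"
    "\<And>g. g \<in> carrier G \<Longrightarrow> S * X g * T = Y g"
proof -
  interpret group G by fact
  have Y: "representation G n Y" and "n > 0"
    using irr by (auto simp: irreducible_representation_def representation_def)
  have "of_nat m = (of_nat n :: complex)"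
    using affords_degree[OF G(1) Y \<theta>(1)] affords_degree[OF G(1) X \<theta>(2)] by simp
  then have mn: "m = n" by simp
  note X = X[unfolded mn]
  have "\<exists>j<n. \<exists>k<n. mat_coeff_average G n X Y j k \<noteq> 0\<^sub>m n n"
  proof (rule ccontr)
    assume "\<not> ?thesis"
    then have z: "(\<Sum>g\<in>carrier G. X g $$ (j, j) * Y (inv g) $$ (k, k)) = 0" if "j < n" "k < n" for j k
      using that by (auto simp: mat_coeff_average_def mat_eq_iff dest!: spec[of _ j])
    \<comment> \<open>Any representation \<open>Z\<close> affording \<open>\<theta>\<close> may
      serve for the first factor, the second always being read off \<open>Y\<close>. The choices
      \<open>Z = X\<close> and \<open>Z = Y\<close> give the two conflicting values.\<close>
    have tr: "(\<Sum>g\<in>carrier G. \<theta> g * \<theta> (inv g))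
        = (\<Sum>j<n. \<Sum>k<n. \<Sum>g\<in>carrier G. Z g $$ (j, j) * Y (inv g) $$ (k, k))"
      if Z: "representation G n Z" "affords G Z \<theta>" for Z
    proof -
      have "(\<Sum>g\<in>carrier G. \<theta> g * \<theta> (inv g))
          = (\<Sum>g\<in>carrier G. (\<Sum>j<n. Z g $$ (j, j)) * (\<Sum>k<n. Y (inv g) $$ (k, k)))"
      proof (rule sum.cong[OF refl])
        fix g assume g: "g \<in> carrier G"
        show "\<theta> g * \<theta> (inv g) = (\<Sum>j<n. Z g $$ (j, j)) * (\<Sum>k<n. Y (inv g) $$ (k, k))"
          using g Z \<theta>(1) representation_carrier[OF Z(1) g] representation_carrier[OF Y, of "inv g"]
          by (auto simp: affords_def mat_trace_def)
      qed
      also have "\<dots> = (\<Sum>g\<in>carrier G. \<Sum>j<n. \<Sum>k<n. Z g $$ (j, j) * Y (inv g) $$ (k, k))"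
        by (simp add: sum_product)
      also have "\<dots> = (\<Sum>j<n. \<Sum>g\<in>carrier G. \<Sum>k<n. Z g $$ (j, j) * Y (inv g) $$ (k, k))"
        by (rule sum.swap)
      also have "\<dots> = (\<Sum>j<n. \<Sum>k<n. \<Sum>g\<in>carrier G. Z g $$ (j, j) * Y (inv g) $$ (k, k))"
        by (intro sum.cong[OF refl] sum.swap)
      finally show ?thesis .
    qed
    have "0 = (\<Sum>g\<in>carrier G. \<theta> g * \<theta> (inv g))"
      using tr[OF X \<theta>(2)] z by simp
    also have "\<dots> = (\<Sum>j<n. \<Sum>k<n. if j = k then of_nat (card (carrier G)) / of_nat n else 0)"
      unfolding tr[OF Y \<theta>(1)] using schur_orthogonality[OF G irr] by simp
    also have "\<dots> = of_nat (card (carrier G))"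
      using \<open>n > 0\<close> by simp
    finally show False using G(2) by auto
  qed
  then obtain j k where jk: "j < n" "k < n" and nz: "mat_coeff_average G n X Y j k \<noteq> 0\<^sub>m n n"
    by blast
  define T where "T = mat_coeff_average G n X Y j k"
  have T: "T \<in> carrier_mat n n" "T \<noteq> 0\<^sub>m n n"
    using nz by (auto simp: T_def mat_coeff_average_def)
  have comm: "X g * T = T * Y g" if "g \<in> carrier G" for g
    unfolding T_def by (rule mat_coeff_average_intertwines[OF G X Y jk that])
  obtain S where S: "S \<in> carrier_mat n n" "S * T = 1\<^sub>m n" "T * S = 1\<^sub>m n"
    using intertwiner_invertible[OF irr X T comm] by blast
  have "S * X g * T = Y g" if g: "g \<in> carrier G" for g
  proof -
    have Xg: "X g \<in> carrier_mat n n" and Yg: "Y g \<in> carrier_mat n n"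
      using representation_carrier[OF X g] representation_carrier[OF Y g] .
    have "S * X g * T = S * (T * Y g)"
      using S T Xg comm[OF g] by (simp add: assoc_mult_mat)
    also have "\<dots> = S * T * Y g"
      using S T Yg by (intro assoc_mult_mat[symmetric]) auto
    finally show ?thesis using S Yg by simp
  qed
  with that S T mn show ?thesis by blast
qed

lemma representation_conjugate:
  assumes G: "group G" and X: "representation G n X"
    and ST: "S \<in> carrier_mat n n" "T \<in> carrier_mat n n" "S * T = 1\<^sub>m n" "T * S = 1\<^sub>m n"
  shows "representation G n (\<lambda>g. S * X g * T)"
proof (rule representationI[OF G])
  show "n > 0" using X by (simp add: representation_def)
  note cX = representation_carrier[OF X]
  show "S * X g * T \<in> carrier_mat n n" if "g \<in> carrier G" for g
    using cX[OF that] ST by auto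
  show "S * X (g \<otimes>\<^bsub>G\<^esub> h) * T = S * X g * T * (S * X h * T)"
    if gh: "g \<in> carrier G" "h \<in> carrier G" for g h
  proof -
    have c: "X g \<in> carrier_mat n n" "X h \<in> carrier_mat n n" using gh cX by auto
    have "S * X g * T * (S * X h * T) = S * X g * (T * (S * (X h * T)))"
      using c ST by (simp add: assoc_mult_mat[of _ n n _ n _ n])
    also have "T * (S * (X h * T)) = T * S * (X h * T)"
      using c ST by (intro assoc_mult_mat[symmetric]) auto
    also have "\<dots> = X h * T" using c ST by simp
    also have "S * X g * (X h * T) = S * (X g * X h) * T"
      using c ST by (simp add: assoc_mult_mat[of _ n n _ n _ n])
    finally show ?thesis using representation_mult[OF X gh] by simp
  qed
  show "S * X \<one>\<^bsub>G\<^esub> * T = 1\<^sub>m n"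
    using representation_one[OF G X] ST by simp
qed

section \<open>Extensions of an irreducible character\<close>

text \<open>A representation affording \<open>\<chi>\<close> restricts on \<open>N\<close> to one
  equivalent to \<open>Y\<close>; conjugating it on all of \<open>G\<close> makes the restriction
  equal to \<open>Y\<close>. Fixing the matrices on \<open>N\<close> is what makes two extensions
  comparable.\<close>

lemma extension_afforded:
  fixes G (structure)
  assumes G: "group G" and N: "subgroup N G" "finite N"
    and irr: "irreducible_representation (G\<lparr>carrier := N\<rparr>) n Y" and \<theta>: "affords (G\<lparr>carrier := N\<rparr>) Y \<theta>"
    and \<chi>: "is_character G \<chi>" "\<And>x. x \<in> N \<Longrightarrow> \<chi> x = \<theta> x"
  obtains Z where "representation G n Z" "affords G Z \<chi>" "\<And>x. x \<in> N \<Longrightarrow> Z x = Y x"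
proof -
  interpret group G by fact
  interpret N: subgroup N G by fact
  obtain m X where X: "representation G m X" "affords G X \<chi>"
    using \<chi>(1) by (auto simp: is_character_def)
  have XN: "representation (G\<lparr>carrier := N\<rparr>) m X"
    using X(1) N.subset by (auto simp: representation_def hom_def)
  have "affords (G\<lparr>carrier := N\<rparr>) X \<theta>"
    using X(2) \<chi>(2) N.subset by (auto simp: affords_def)
  from intertwiner_exists[OF _ _ irr XN \<theta> this] obtain S T where
    ST: "m = n" "S \<in> carrier_mat n n" "T \<in> carrier_mat n n" "S * T = 1\<^sub>m n" "T * S = 1\<^sub>m n"
    "\<And>g. g \<in> N \<Longrightarrow> S * X g * T = Y g"
    using N.subgroup_is_group[OF G] N(2) by auto
  note X = X[unfolded ST(1)]
  have "affords G (\<lambda>g. S * X g * T) \<chi>"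
    using X mat_trace_conjugate[OF _ ST(2,3,5)] representation_carrier[OF X(1)]
    by (auto simp: affords_def)
  then show ?thesis
    using that[OF representation_conjugate[OF G X(1) ST(2-5)]] ST(6) by blast
qed

text \<open>If \<open>\<chi>\<close> vanished on the coset of \<open>h\<close>, then
  \<open>Z h\<close> would be orthogonal under the trace form to every \<open>Z x\<close> with
  \<open>x\<close> in \<open>N\<close>. Schur orthogonality turns this into \<open>Z h = 0\<close>,
  although \<open>Z h\<close> is invertible.\<close>

lemma extension_not_zero_on_coset:
  fixes G (structure)
  assumes G: "group G" and N: "subgroup N G" "finite N"
    and \<theta>: "irreducible_character (G\<lparr>carrier := N\<rparr>) \<theta>"
    and \<chi>: "is_character G \<chi>" "\<And>x. x \<in> N \<Longrightarrow> \<chi> x = \<theta> x"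
    and h: "h \<in> carrier G"
  shows "\<exists>x\<in>N. \<chi> (x \<otimes>\<^bsub>G\<^esub> h) \<noteq> 0"
proof (rule ccontr)
  assume "\<not> ?thesis"
  then have z: "\<chi> (x \<otimes>\<^bsub>G\<^esub> h) = 0" if "x \<in> N" for x using that by blast
  interpret group G by fact
  interpret N: subgroup N G by fact
  obtain n Y where Y: "irreducible_representation (G\<lparr>carrier := N\<rparr>) n Y" "affords (G\<lparr>carrier := N\<rparr>) Y \<theta>"
    using \<theta> by (auto simp: irreducible_character_def)
  obtain Z where Z: "representation G n Z" "affords G Z \<chi>" "\<And>x. x \<in> N \<Longrightarrow> Z x = Y x"
    using extension_afforded[OF G N Y \<chi>] by blast
  have "n > 0" using Z by (simp add: representation_def)
  note cZ = representation_carrier[OF Z(1)]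
  have inv: "inv\<^bsub>G\<lparr>carrier := N\<rparr>\<^esub> x = inv x" if "x \<in> N" for x
    using m_inv_consistent[OF N(1) that] .
  have expand: "\<chi> (x \<otimes> h) = (\<Sum>i<n. \<Sum>j<n. Z x $$ (i, j) * Z h $$ (j, i))" if x: "x \<in> N" for x
  proof -
    have xG: "x \<in> carrier G" using x by simp
    have "\<chi> (x \<otimes> h) = mat_trace (Z x * Z h)"
      using Z(2) representation_mult[OF Z(1) xG h] xG h by (simp add: affords_def)
    also have "\<dots> = (\<Sum>i<n. \<Sum>j<n. Z x $$ (i, j) * Z h $$ (j, i))"
      using cZ[OF xG] cZ[OF h] by (simp add: mat_trace_def scalar_prod_def atLeast0LessThan)
    finally show ?thesis .
  qed
  have "Z h $$ (k, l) = 0" if kl: "k < n" "l < n" for k l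
  proof -
    \<comment> \<open>Weighting by the coefficient \<open>Z (inv x) $$ (k, l)\<close> isolates a
      single entry of \<open>Z h\<close>, up to the nonzero factor
      \<open>card N / n\<close>.\<close>
    have "0 = (\<Sum>x\<in>N. \<chi> (x \<otimes> h) * Z (inv x) $$ (k, l))"
      using z by simp
    also have "\<dots> = (\<Sum>x\<in>N. \<Sum>i<n. \<Sum>j<n. Z h $$ (j, i) * (Z x $$ (i, j) * Z (inv x) $$ (k, l)))"
      by (rule sum.cong) (auto simp: expand sum_distrib_left sum_distrib_right mult_ac)
    also have "\<dots> = (\<Sum>i<n. \<Sum>x\<in>N. \<Sum>j<n. Z h $$ (j, i) * (Z x $$ (i, j) * Z (inv x) $$ (k, l)))"
      by (rule sum.swap)
    also have "\<dots> = (\<Sum>i<n. \<Sum>j<n. \<Sum>x\<in>N. Z h $$ (j, i) * (Z x $$ (i, j) * Z (inv x) $$ (k, l)))"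
      by (intro sum.cong[OF refl] sum.swap)
    also have "\<dots> = (\<Sum>i<n. \<Sum>j<n. Z h $$ (j, i) * (\<Sum>x\<in>N. Z x $$ (i, j) * Z (inv x) $$ (k, l)))"
      by (simp add: sum_distrib_left)
    also have "\<dots> = (\<Sum>i<n. \<Sum>j<n. Z h $$ (j, i) *
        (if i = l \<and> j = k then of_nat (card N) / of_nat n else 0))"
    proof (intro sum.cong[OF refl] arg_cong2[of _ _ _ _ "(*)"])
      fix i j assume "i \<in> {..<n}" "j \<in> {..<n}"
      then show "(\<Sum>x\<in>N. Z x $$ (i, j) * Z (inv x) $$ (k, l))
        = (if i = l \<and> j = k then of_nat (card N) / of_nat n else 0)"
        using schur_orthogonality[OF N.subgroup_is_group[OF G] _ Y(1), of i j k l] kl N(2)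
        by (simp add: inv Z(3))
    qed simp
    also have "\<dots> = (\<Sum>i<n. if i = l then Z h $$ (k, l) * (of_nat (card N) / of_nat n) else 0)"
    proof (intro sum.cong[OF refl])
      fix i
      show "(\<Sum>j<n. Z h $$ (j, i) * (if i = l \<and> j = k then of_nat (card N) / of_nat n else 0))
        = (if i = l then Z h $$ (k, l) * (of_nat (card N) / of_nat n) else 0)"
        using kl by (cases "i = l") (simp_all only: mult_zero_right if_distrib[of "(*) _"] sum.delta
          finite_lessThan lessThan_iff if_True if_False simp_thms sum.neutral_const)
    qed
    also have "\<dots> = Z h $$ (k, l) * (of_nat (card N) / of_nat n)"
      using kl by (simp only: sum.delta finite_lessThan lessThan_iff if_True)
    finally have "Z h $$ (k, l) * (of_nat (card N) / of_nat n) = 0" by simp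
    moreover have "card N > 0" using N(2) N.one_closed card_gt_0_iff by blast
    ultimately show ?thesis using \<open>n > 0\<close> by simp
  qed
  then have "Z h = 0\<^sub>m n n" using cZ[OF h] by (intro eq_matI) auto
  then have "(0\<^sub>m n n :: complex mat) = 1\<^sub>m n"
    using representation_inv(1)[OF G Z(1) h] cZ[of "inv h"] h by simp
  then have "(0\<^sub>m n n :: complex mat) $$ (0, 0) = 1\<^sub>m n $$ (0, 0)" by simp
  then show False using \<open>n > 0\<close> by simp
qed

text \<open>Representations affording the two characters can be chosen equal on \<open>N\<close>.
  They then differ at each \<open>h\<close> by a scalar, and \<open>c\<close> collects these
  scalars.\<close>

lemma extensions_differ_by_linear:
  fixes G (structure)
  assumes G: "group G" and N: "N \<lhd> G" "finite N"
    and \<theta>: "irreducible_character (G\<lparr>carrier := N\<rparr>) \<theta>"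
    and \<chi>: "is_character G \<chi>" "\<And>x. x \<in> N \<Longrightarrow> \<chi> x = \<theta> x"
    and \<chi>': "is_character G \<chi>'" "\<And>x. x \<in> N \<Longrightarrow> \<chi>' x = \<theta> x"
  shows "\<exists>c. (\<forall>x\<in>carrier G. \<forall>y\<in>carrier G. c (x \<otimes> y) = c x * c y) \<and> (\<forall>x\<in>N. c x = 1)
    \<and> (\<forall>x\<in>carrier G. \<chi>' x = c x * \<chi> x)"
proof -
  interpret group G by fact
  interpret N: normal N G by fact
  have subN: "subgroup N G" by (rule N.subgroup_axioms)
  obtain n Y where Y: "irreducible_representation (G\<lparr>carrier := N\<rparr>) n Y" "affords (G\<lparr>carrier := N\<rparr>) Y \<theta>"
    using \<theta> by (auto simp: irreducible_character_def)
  obtain Z where Z: "representation G n Z" "affords G Z \<chi>" "\<And>x. x \<in> N \<Longrightarrow> Z x = Y x"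
    using extension_afforded[OF G subN N(2) Y \<chi>] by blast
  obtain Z' where Z': "representation G n Z'" "affords G Z' \<chi>'" "\<And>x. x \<in> N \<Longrightarrow> Z' x = Y x"
    using extension_afforded[OF G subN N(2) Y \<chi>'] by blast
  have "n > 0" using Z by (simp add: representation_def)
  note cZ = representation_carrier[OF Z(1)] and cZ' = representation_carrier[OF Z'(1)]
  note assoc = assoc_mult_mat[of _ n n _ n _ n]
  have "\<exists>a. Z' h = a \<cdot>\<^sub>m Z h" if h: "h \<in> carrier G" for h
  proof -
    \<comment> \<open>\<open>A\<close> commutes with \<open>Y\<close> because \<open>Z\<close> and \<open>Z'\<close> agree on \<open>N\<close>, so Schur's lemma applies.\<close>
    define A where "A = Z (inv h) * Z' h"
    have A: "A \<in> carrier_mat n n" using cZ[of "inv h"] cZ'[OF h] h by (simp add: A_def)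
    have "A * Y x = Y x * A" if x: "x \<in> N" for x
    proof -
      define y where "y = h \<otimes> x \<otimes> inv h"
      have y: "y \<in> N" unfolding y_def using x h by (simp add: N.inv_op_closed2)
      have xG: "x \<in> carrier G" and yG: "y \<in> carrier G" using x y by auto
      have eq: "h \<otimes> x = y \<otimes> h" "inv h \<otimes> y = x \<otimes> inv h"
        using h xG by (simp_all add: y_def m_assoc inv_solve_left')
      have "A * Y x = Z (inv h) * (Z' h * Z' x)"
        using cZ[of "inv h"] cZ'[OF h] cZ'[OF xG] Z'(3)[OF x] h by (simp add: A_def assoc)
      also have "\<dots> = Z (inv h) * (Z' y * Z' h)"
        using representation_mult[OF Z'(1)] h xG yG eq(1) by metis
      also have "\<dots> = Z (inv h) * Z y * Z' h"
        using cZ[of "inv h"] cZ'[OF h] cZ[OF yG] Z'(3)[OF y] Z(3)[OF y] h by (simp add: assoc)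
      also have "\<dots> = Z x * Z (inv h) * Z' h"
        using representation_mult[OF Z(1)] h xG yG eq(2) inv_closed by metis
      also have "\<dots> = Y x * A"
        using cZ[of "inv h"] cZ'[OF h] cZ[OF xG] Z(3)[OF x] h by (simp add: A_def assoc)
      finally show ?thesis .
    qed
    then obtain a where a: "A = a \<cdot>\<^sub>m 1\<^sub>m n"
      using schur_lemma[OF Y(1) A] by auto
    have "Z' h = Z h * A"
      using cZ[of "inv h"] cZ'[OF h] cZ[OF h] h representation_inv(1)[OF G Z(1) h]
      by (simp add: A_def assoc[symmetric])
    also have "\<dots> = a \<cdot>\<^sub>m Z h"
      unfolding a using mult_smult_distrib[OF cZ[OF h] one_carrier_mat] cZ[OF h] by simp
    finally show ?thesis by blast
  qed
  then obtain c where c: "\<And>h. h \<in> carrier G \<Longrightarrow> Z' h = c h \<cdot>\<^sub>m Z h" by metis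
  \<comment> \<open>Since \<open>Z h\<close> is invertible, a scalar is determined by its product
    with \<open>Z h\<close>. Both the multiplicativity of \<open>c\<close> and its triviality on
    \<open>N\<close> are obtained by this comparison.\<close>
  have cancel: "a = b" if eq: "a \<cdot>\<^sub>m Z h = b \<cdot>\<^sub>m Z h" and h: "h \<in> carrier G" for a b h
  proof -
    have "(a \<cdot>\<^sub>m Z h) * Z (inv h) = (b \<cdot>\<^sub>m Z h) * Z (inv h)" using eq by simp
    then have "a \<cdot>\<^sub>m 1\<^sub>m n = b \<cdot>\<^sub>m (1\<^sub>m n :: complex mat)"
      using cZ[OF h] cZ[of "inv h"] h representation_inv(1)[OF G Z(1) h]
      by (simp add: mult_smult_assoc_mat)
    then have "(a \<cdot>\<^sub>m 1\<^sub>m n) $$ (0, 0) = (b \<cdot>\<^sub>m (1\<^sub>m n :: complex mat)) $$ (0, 0)" by simp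
    then show ?thesis using \<open>n > 0\<close> by simp
  qed
  show ?thesis
  proof (intro exI[of _ c] conjI ballI)
    fix x y assume xy: "x \<in> carrier G" "y \<in> carrier G"
    have "c (x \<otimes> y) \<cdot>\<^sub>m Z (x \<otimes> y) = (c x \<cdot>\<^sub>m Z x) * (c y \<cdot>\<^sub>m Z y)"
      using c xy representation_mult[OF Z'(1) xy] by simp
    also have "\<dots> = (c x * c y) \<cdot>\<^sub>m Z (x \<otimes> y)"
      using cZ[OF xy(1)] cZ[OF xy(2)] representation_mult[OF Z(1) xy]
      by (intro eq_matI) (auto simp: mult_smult_assoc_mat[of _ n n _ n] mult_smult_distrib[of _ n n _ n])
    finally show "c (x \<otimes> y) = c x * c y" using cancel[of _ "x \<otimes> y"] xy by simp
  next
    fix x assume x: "x \<in> N"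
    then have "c x \<cdot>\<^sub>m Z x = 1 \<cdot>\<^sub>m Z x"
      using c[of x] Z(3) Z'(3) by (auto intro!: eq_matI)
    then show "c x = 1" using cancel[of _ x] N.subset x by blast
  next
    fix x assume x: "x \<in> carrier G"
    then show "\<chi>' x = c x * \<chi> x"
      using Z(2) Z'(2) c[OF x] cZ[OF x]
      by (simp add: affords_def mat_trace_def sum_distrib_left)
  qed
qed

section \<open>Transfer\<close>

text \<open>The hypothesis on \<open>m\<close> makes \<open>s\<close> a permutation of
  \<open>S\<close>, and the product splits over its cycles. Since \<open>cycle\<close> speaks of
  every return time of a point, an application can ignore the actual cycle lengths.\<close>

lemma prod_eq_power_if_cycles:
  fixes f :: "'c \<Rightarrow> 'd::comm_monoid_mult"
  assumes "finite S" "s ` S \<subseteq> S" and m: "m > 0" "\<And>x. x \<in> S \<Longrightarrow> (s ^^ m) x = x"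
    and cycle: "\<And>x n. x \<in> S \<Longrightarrow> (s ^^ n) x = x \<Longrightarrow> (\<Prod>i<n. f ((s ^^ i) x)) = c ^ n"
  shows "prod f S = c ^ card S"
proof -
  have "prod f A = c ^ card A" if "finite A" "A \<subseteq> S" "s ` A \<subseteq> A" for A
    using that
  proof (induction A rule: finite_psubset_induct)
    case (psubset A)
    note A = psubset.hyps psubset.prems
    show ?case
    proof (cases "A = {}")
      case False
      then obtain x where x: "x \<in> A" by blast
      then have xS: "x \<in> S" using A by blast
      have inj: "inj_on s A"
      proof (rule inj_on_inverseI)
        fix y assume "y \<in> A"
        then have "(s ^^ m) y = y" using m A by blast
        then show "(s ^^ (m - 1)) (s y) = y"
          using m(1) by (metis Suc_diff_1 comp_apply funpow_Suc_right)
      qed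
      \<comment> \<open>\<open>n\<close> is the length of the cycle through \<open>x\<close>, and
        \<open>C\<close> below is the cycle itself; removing it leaves a smaller stable set for the
        induction.\<close>
      define n where "n = (LEAST n. n > 0 \<and> (s ^^ n) x = x)"
      have n: "n > 0 \<and> (s ^^ n) x = x"
        unfolding n_def by (rule LeastI[of _ m]) (use m xS in auto)
      have least: "n \<le> k" if "k > 0" "(s ^^ k) x = x" for k
        unfolding n_def by (rule Least_le) (use that in auto)
      define C where "C = (\<lambda>i. (s ^^ i) x) ` {..<n}"
      have in_A: "(s ^^ i) x \<in> A" for i
        using x A by (induction i) auto
      have inj_C: "inj_on (\<lambda>i. (s ^^ i) x) {..<n}"
      proof (rule linorder_inj_onI)
        fix i j assume ij: "i < j" "i \<in> {..<n}" "j \<in> {..<n}"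
        show "(s ^^ i) x \<noteq> (s ^^ j) x"
        proof
          assume "(s ^^ i) x = (s ^^ j) x"
          \<comment> \<open>Applying \<open>s ^^ (n - j)\<close> brings the second orbit point back
            to \<open>x\<close>, so \<open>n - j + i\<close> would be a positive return time below
            \<open>n\<close>.\<close>
          then have "(s ^^ (n - j)) ((s ^^ i) x) = (s ^^ (n - j)) ((s ^^ j) x)" by simp
          then have "(s ^^ (n - j + i)) x = (s ^^ (n - j + j)) x"
            by (simp only: funpow_add comp_apply)
          then have "(s ^^ (n - j + i)) x = x" using n ij by simp
          then show False using least[of "n - j + i"] ij by simp
        qed
      qed (auto simp: linear)
      have C: "C \<subseteq> A" "finite C" "card C = n"
        using in_A inj_C by (auto simp: C_def card_image)
      have "s ` C \<subseteq> C"
      proof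
        fix y assume "y \<in> s ` C"
        then obtain i where i: "i < n" "y = (s ^^ Suc i) x" by (auto simp: C_def)
        show "y \<in> C"
        proof (cases "Suc i = n")
          case True
          then have "y = (s ^^ 0) x" using i n by simp
          then show ?thesis using n unfolding C_def by blast
        next
          case False
          then show ?thesis
            using i unfolding C_def by (intro image_eqI[of _ _ "Suc i"]) auto
        qed
      qed
      then have "s ` C = C"
        using inj C by (meson endo_inj_surj inj_on_subset)
      then have "s ` (A - C) \<subseteq> A - C"
        using inj_on_image_set_diff[OF inj, of A C] A C by auto
      moreover have "A - C \<subset> A"
        using x n C unfolding C_def by (auto intro!: image_eqI[of _ _ 0])
      ultimately have "prod f (A - C) = c ^ card (A - C)"
        using psubset.IH[of "A - C"] A by blast
      moreover have "prod f C = c ^ n"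
        using cycle[OF xS, of n] n inj_C by (simp add: C_def prod.reindex)
      ultimately have "prod f A = c ^ (card (A - C) + n)"
        using prod.subset_diff[OF C(1) \<open>finite A\<close>, of f] by (simp add: power_add)
      also have "card (A - C) + n = card A"
        using C \<open>finite A\<close> card_mono[of A C] by (simp add: card_Diff_subset)
      finally show ?thesis .
    qed simp
  qed
  then show ?thesis using assms(1,2) by blast
qed

section \<open>The transfer homomorphism\<close>

context group
begin

lemma inv_mult_cancel:
  "a \<in> carrier G \<Longrightarrow> b \<in> carrier G \<Longrightarrow> inv a \<otimes> (a \<otimes> b) = b"
  by (simp flip: m_assoc)

lemma mult_inv_cancel:
  "a \<in> carrier G \<Longrightarrow> b \<in> carrier G \<Longrightarrow> a \<otimes> (inv a \<otimes> b) = b"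
  by (simp flip: m_assoc)

text \<open>The classical transfer into \<open>P\<close> followed by \<open>c\<close>; the chosen
  elements of the right cosets form the transversal. Applying \<open>c\<close> to each factor and
  multiplying in a commutative monoid takes the place of the abelianization of
  \<open>P\<close>.\<close>

definition transfer :: "'a set \<Rightarrow> ('a \<Rightarrow> 'c::comm_monoid_mult) \<Rightarrow> 'a \<Rightarrow> 'c" where
  "transfer P c g = (\<Prod>C\<in>rcosets P. c ((SOME x. x \<in> C) \<otimes> g \<otimes> inv (SOME x. x \<in> C #> g)))"

lemma rcoset_r_coset:
  assumes "subgroup P G" "C \<in> rcosets P" "g \<in> carrier G" "h \<in> carrier G"
  shows "C #> g \<in> rcosets P" "C #> g #> h = C #> (g \<otimes> h)"
proof -
  have P: "P \<subseteq> carrier G" using assms(1) by (rule subgroup.subset)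
  obtain a where a: "a \<in> carrier G" "C = P #> a"
    using assms(2) by (auto simp: RCOSETS_def)
  show "C #> g \<in> rcosets P"
    using a P assms(3) by (simp add: coset_mult_assoc rcosetsI)
  show "C #> g #> h = C #> (g \<otimes> h)"
    using a P assms(3,4) by (simp add: coset_mult_assoc m_assoc)
qed

lemma rcoset_repr:
  assumes P: "subgroup P G" and C: "C \<in> rcosets P"
  shows "(SOME x. x \<in> C) \<in> C" "(SOME x. x \<in> C) \<in> carrier G" "P #> (SOME x. x \<in> C) = C"
proof -
  obtain a where a: "a \<in> carrier G" "C = P #> a"
    using C by (auto simp: RCOSETS_def)
  then have "a \<in> C" using rcos_self P by blast
  then show in_C: "(SOME x. x \<in> C) \<in> C" by (rule someI)
  then show "(SOME x. x \<in> C) \<in> carrier G"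
    using a P r_coset_subset_G subgroup.subset by blast
  show "P #> (SOME x. x \<in> C) = C"
    using repr_independence[of _ P a] in_C a P by metis
qed

text \<open>This confines the arguments of \<open>c\<close> in the transfer to \<open>P\<close>: the
  elements \<open>t \<otimes> g\<close> and \<open>u\<close> lie in the same right coset.\<close>

lemma transfer_factor_mem:
  assumes P: "subgroup P G" and C: "C \<in> rcosets P" and g: "g \<in> carrier G"
  shows "(SOME x. x \<in> C) \<otimes> g \<otimes> inv (SOME x. x \<in> C #> g) \<in> P"
proof -
  define t u where "t = (SOME x. x \<in> C)" and "u = (SOME x. x \<in> C #> g)"
  have t: "t \<in> carrier G" "t \<in> C" "P #> t = C"
    using rcoset_repr[OF P C] by (auto simp: t_def)
  have Cg: "C #> g \<in> rcosets P" using rcoset_r_coset(1)[OF P C g g] .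
  have u: "u \<in> carrier G" "P #> u = C #> g"
    using rcoset_repr[OF P Cg] by (auto simp: u_def)
  have "t \<otimes> g \<in> P #> u"
    using t(2) g unfolding u(2) by (auto simp: r_coset_def)
  then obtain p where p: "p \<in> P" "t \<otimes> g = p \<otimes> u" by (auto simp: r_coset_def)
  then have "t \<otimes> g \<otimes> inv u = p"
    using u(1) P subgroup.mem_carrier by (fastforce simp: m_assoc)
  then show ?thesis using p by (simp add: t_def u_def)
qed

text \<open>The factor of \<open>g \<otimes> h\<close> at a coset \<open>C\<close> is the factor of
  \<open>g\<close> at \<open>C\<close> times that of \<open>h\<close> at \<open>C #> g\<close>. As
  \<open>C\<close> runs over all cosets, so does \<open>C #> g\<close>.\<close>

lemma transfer_mult:
  assumes P: "subgroup P G"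
    and c: "\<And>x y. x \<in> P \<Longrightarrow> y \<in> P \<Longrightarrow> c (x \<otimes> y) = c x * c y"
    and gh: "g \<in> carrier G" "h \<in> carrier G"
  shows "transfer P c (g \<otimes> h) = transfer P c g * transfer P c h"
proof -
  define t where "t C = (SOME x. x \<in> C)" for C :: "'a set"
  note t = rcoset_repr[OF P, folded t_def]
  note tP = transfer_factor_mem[OF P, folded t_def]
  have bij: "bij_betw (\<lambda>C. C #> g) (rcosets P) (rcosets P)"
  proof (rule bij_betwI[where g = "\<lambda>C. C #> inv g"])
    fix C assume C: "C \<in> rcosets P"
    then have "C \<subseteq> carrier G" using P rcosets_part_G by blast
    then show "C #> g #> inv g = C" "C #> inv g #> g = C"
      using rcoset_r_coset(2)[OF P C] gh by auto
  qed (use rcoset_r_coset(1)[OF P] gh in auto)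
  have "transfer P c (g \<otimes> h) = (\<Prod>C\<in>rcosets P.
      c (t C \<otimes> g \<otimes> inv t (C #> g)) * c (t (C #> g) \<otimes> h \<otimes> inv t (C #> g #> h)))"
    unfolding transfer_def t_def[symmetric]
  proof (rule prod.cong[OF refl])
    fix C assume C: "C \<in> rcosets P"
    have Cg: "C #> g \<in> rcosets P" and Cgh: "C #> g #> h = C #> (g \<otimes> h)"
      using rcoset_r_coset[OF P C gh] by auto
    have Cgh': "C #> g #> h \<in> rcosets P"
      by (rule rcoset_r_coset(1)[OF P Cg gh(2) gh(2)])
    have "t C \<otimes> (g \<otimes> h) \<otimes> inv t (C #> (g \<otimes> h))
      = (t C \<otimes> g \<otimes> inv t (C #> g)) \<otimes> (t (C #> g) \<otimes> h \<otimes> inv t (C #> g #> h))"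
      using t(2)[OF C] t(2)[OF Cg] t(2)[OF Cgh'] gh unfolding Cgh
      by (simp add: m_assoc inv_mult_cancel)
    then show "c (t C \<otimes> (g \<otimes> h) \<otimes> inv t (C #> (g \<otimes> h)))
      = c (t C \<otimes> g \<otimes> inv t (C #> g)) * c (t (C #> g) \<otimes> h \<otimes> inv t (C #> g #> h))"
      using c tP[OF C gh(1)] tP[OF Cg gh(2)] by simp
  qed
  also have "\<dots> = transfer P c g * (\<Prod>C\<in>rcosets P. c (t (C #> g) \<otimes> h \<otimes> inv t (C #> g #> h)))"
    by (simp add: prod.distrib transfer_def t_def)
  also have "(\<Prod>C\<in>rcosets P. c (t (C #> g) \<otimes> h \<otimes> inv t (C #> g #> h))) = transfer P c h"
    using prod.reindex_bij_betw[OF bij, of "\<lambda>C. c (t C \<otimes> h \<otimes> inv t (C #> h))"]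
    by (simp add: transfer_def t_def)
  finally show ?thesis .
qed

lemma transfer_one:
  assumes P: "subgroup P G" and c: "c \<one> = 1"
  shows "transfer P c \<one> = 1"
  unfolding transfer_def
proof (rule prod.neutral, rule ballI)
  fix C assume C: "C \<in> rcosets P"
  then have "C \<subseteq> carrier G" using P rcosets_part_G by blast
  then show "c ((SOME x. x \<in> C) \<otimes> \<one> \<otimes> inv (SOME x. x \<in> C #> \<one>)) = 1"
    using rcoset_repr(2)[OF P C] c by simp
qed

text \<open>The transfer is evaluated along the cycles of \<open>x\<close> on the cosets. On a cycle
  of length \<open>n\<close> the factors multiply to a conjugate of \<open>x [^] n\<close>, where
  the conjugation invariant \<open>c\<close> takes the value \<open>c x ^ n\<close>.\<close>

lemma transfer_eq_power:
  assumes fin: "finite (carrier G)" and P: "subgroup P G"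
    and c: "\<And>x y. x \<in> P \<Longrightarrow> y \<in> P \<Longrightarrow> c (x \<otimes> y) = c x * c y"
    and x: "x \<in> carrier G" "\<And>n::nat. c (x [^] n) = c x ^ n"
    and conj: "\<And>g y. g \<in> carrier G \<Longrightarrow> y \<in> carrier G \<Longrightarrow> c (g \<otimes> y \<otimes> inv g) = c y"
  shows "transfer P c x = c x ^ card (rcosets P)"
proof -
  define t where "t C = (SOME x. x \<in> C)" for C :: "'a set"
  note t = rcoset_repr[OF P, folded t_def]
  note tP = transfer_factor_mem[OF P, folded t_def]
  have "c \<one> = 1" using x(2)[of 0] by simp
  have sub: "C \<subseteq> carrier G" if "C \<in> rcosets P" for C
    using that P rcosets_part_G by blast
  have pow: "((\<lambda>C. C #> x) ^^ i) C = C #> x [^] i" if C: "C \<in> rcosets P" for C i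
    using sub[OF C] rcoset_r_coset(2)[OF P C _ x(1)] x(1) by (induction i) auto
  \<comment> \<open>The representative closing one factor opens the next, so only the two outer ones
    survive.\<close>
  have telescope: "(\<Prod>i<n. c (t (C #> x [^] i) \<otimes> x \<otimes> inv t (C #> x [^] i #> x)))
      = c (t C \<otimes> x [^] n \<otimes> inv t (C #> x [^] n))" if C: "C \<in> rcosets P" for C and n :: nat
  proof (induction n)
    case 0
    then show ?case using sub[OF C] t(2)[OF C] \<open>c \<one> = 1\<close> by simp
  next
    case (Suc n)
    have xn: "x [^] n \<in> carrier G" using x(1) by simp
    have Cn: "C #> x [^] n \<in> rcosets P" and CS: "C #> x [^] n #> x = C #> x [^] Suc n"
      and CS': "C #> x [^] Suc n \<in> rcosets P"
      using rcoset_r_coset[OF P C xn x(1)] rcoset_r_coset(1)[OF P C _ x(1), of "x [^] Suc n"] x(1)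
      by auto
    have "(t C \<otimes> x [^] n \<otimes> inv t (C #> x [^] n)) \<otimes> (t (C #> x [^] n) \<otimes> x \<otimes> inv t (C #> x [^] n #> x))
      = t C \<otimes> x [^] Suc n \<otimes> inv t (C #> x [^] Suc n)"
      using t(2)[OF C] t(2)[OF Cn] t(2)[OF CS'] xn x(1) unfolding CS
      by (simp add: m_assoc inv_mult_cancel)
    then show ?case
      using Suc.IH c[OF tP[OF C xn] tP[OF Cn x(1)]] by simp
  qed
  have "transfer P c x = (\<Prod>C\<in>rcosets P. c (t C \<otimes> x \<otimes> inv t (C #> x)))"
    by (simp add: transfer_def t_def)
  also have "\<dots> = c x ^ card (rcosets P)"
  \<comment> \<open>After \<open>ord x\<close> steps every coset returns, since that power of
    \<open>x\<close> is the identity.\<close>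
  proof (rule prod_eq_power_if_cycles[where s = "\<lambda>C. C #> x" and m = "ord x"])
    show "finite (rcosets P)"
      using fin P sub by (meson PowI finite_Pow_iff finite_subset subsetI)
    show "(\<lambda>C. C #> x) ` (rcosets P) \<subseteq> rcosets P"
      using rcoset_r_coset(1)[OF P _ x(1) x(1)] by auto
    show "ord x > 0" using fin x(1) ord_ge_1 by fastforce
    fix C assume C: "C \<in> rcosets P"
    show "((\<lambda>C. C #> x) ^^ ord x) C = C"
      using pow[OF C] x(1) sub[OF C] by simp
    fix n assume n: "((\<lambda>C. C #> x) ^^ n) C = C"
    have "(\<Prod>i<n. c (t (((\<lambda>C. C #> x) ^^ i) C) \<otimes> x \<otimes> inv t (((\<lambda>C. C #> x) ^^ i) C #> x)))
      = c (t C \<otimes> x [^] n \<otimes> inv t C)"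
      using telescope[OF C, of n] n by (simp add: pow[OF C])
    also have "\<dots> = c x ^ n"
      using conj[OF t(2)[OF C]] x by simp
    finally show "(\<Prod>i<n. c (t (((\<lambda>C. C #> x) ^^ i) C) \<otimes> x \<otimes> inv t (((\<lambda>C. C #> x) ^^ i) C #> x)))
      = c x ^ n" .
  qed
  finally show ?thesis .
qed

section \<open>Extension from the \<open>\<sigma>\<close>-subgroups by a greatest common divisor
  argument\<close>

lemma extend_linear_from_pi_subgroups:
  fixes c :: "'a \<Rightarrow> complex"
  assumes fin: "finite (carrier G)" and c1: "c \<one> = 1"
    and conj: "\<And>g y. g \<in> carrier G \<Longrightarrow> y \<in> carrier G \<Longrightarrow> c (g \<otimes> y \<otimes> inv g) = c y"
    and hom: "\<And>H x y. subgroup H G \<Longrightarrow> pi_number \<sigma> (card H) \<Longrightarrow> x \<in> H \<Longrightarrow> y \<in> H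
      \<Longrightarrow> c (x \<otimes> y) = c x * c y"
  shows "\<exists>\<mu>. \<mu> \<one> = 1 \<and> (\<forall>x\<in>carrier G. \<forall>y\<in>carrier G. \<mu> (x \<otimes> y) = \<mu> x * \<mu> y)
    \<and> (\<forall>x\<in>carrier G. pi_number \<sigma> (ord x) \<longrightarrow> \<mu> x = c x)"
proof -
  define ext where "ext k \<mu> \<longleftrightarrow> \<mu> \<one> = 1 \<and> (\<forall>x\<in>carrier G. \<forall>y\<in>carrier G. \<mu> (x \<otimes> y) = \<mu> x * \<mu> y)
    \<and> (\<forall>x\<in>carrier G. pi_number \<sigma> (ord x) \<longrightarrow> \<mu> x = c x ^ k)" for k :: nat and \<mu> :: "'a \<Rightarrow> complex"
  \<comment> \<open>The exponents \<open>k\<close> for which \<open>c\<^sup>k\<close> extends are the nonnegative elements of an ideal of the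
    integers; we show that its generator \<open>d\<close> is \<open>1\<close>.\<close>
  define I where "I = {k. \<exists>\<mu>. ext k \<mu>}"
  \<comment> \<open>The cyclic group generated by \<open>x\<close> has order \<open>ord x\<close>,
    so \<open>hom\<close> applies to it.\<close>
  have c_pow: "c (x [^] n) = c x ^ n" if x: "x \<in> carrier G" "pi_number \<sigma> (ord x)" for x and n :: nat
  proof (induction n)
    case (Suc n)
    have sub: "subgroup (generate G {x}) G"
      using x(1) by (intro generate_is_subgroup) auto
    have "x \<in> generate G {x}" by (simp add: generate.incl)
    moreover from this have "x [^] n \<in> generate G {x}"
      using subgroup.one_closed[OF sub] subgroup.m_closed[OF sub] by (induction n) auto
    moreover have "pi_number \<sigma> (card (generate G {x}))"
      using x generate_pow_card by simp
    ultimately show ?case using hom[OF sub] Suc.IH by simp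
  qed (simp add: c1)
  have c_ord: "c x ^ ord x = 1" if "x \<in> carrier G" "pi_number \<sigma> (ord x)" for x
    using c_pow[OF that, of "ord x"] that c1 by simp
  have c_nz: "c x \<noteq> 0" if x: "x \<in> carrier G" "pi_number \<sigma> (ord x)" for x
  proof
    assume "c x = 0"
    then show False using c_ord[OF x] x by (simp add: pi_number_def power_0_left)
  qed
  have "Coset.order G > 0" using fin by (simp add: order_gt_0_iff_finite)
  \<comment> \<open>\<open>m\<close> is the \<open>\<sigma>\<close>-part of the group order. The
    power \<open>c ^ m\<close> is 1 on \<open>\<sigma>\<close>-elements, so the constant function 1
    extends it and \<open>I\<close> has a positive member.\<close>
  then obtain m k where mk: "Coset.order G = m * k" "pi_number \<sigma> m" "pi_number (compl_primes \<sigma>) k"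
    by (rule pi_number_factorization)
  have "c x ^ m = 1" if x: "x \<in> carrier G" "pi_number \<sigma> (ord x)" for x
  proof -
    have "ord x dvd m * k" using ord_dvd_group_order[OF x(1)] mk by simp
    then have "ord x dvd m"
      using pi_number_coprime[OF x(2) mk(3)] by (simp add: coprime_dvd_mult_left_iff)
    then show ?thesis using c_ord[OF x] by (auto elim!: dvdE simp: power_mult)
  qed
  then have "ext m (\<lambda>_. 1)" by (simp add: ext_def)
  then have mI: "m \<in> I" and "m > 0" using mk(2) by (auto simp: I_def pi_number_def)
  have indexI: "card (rcosets P) \<in> I" if P: "subgroup P G" "pi_number \<sigma> (card P)" for P
  proof -
    note cP = hom[OF P]
    have "ext (card (rcosets P)) (transfer P c)"
      unfolding ext_def
      using transfer_one[where c = c, OF P(1) c1] transfer_mult[where c = c, OF P(1) cP]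
        transfer_eq_power[where c = c, OF fin P(1) cP] c_pow conj by blast
    then show ?thesis by (auto simp: I_def)
  qed
  define d where "d = (LEAST k. k > 0 \<and> k \<in> I)"
  have d: "d > 0 \<and> d \<in> I"
    unfolding d_def by (rule LeastI[of _ m]) (use mI \<open>m > 0\<close> in auto)
  then obtain \<mu>d where \<mu>d: "ext d \<mu>d" by (auto simp: I_def)
  \<comment> \<open>Division with remainder: dividing an extension for \<open>k\<close> by a power
    of the one for \<open>d\<close> yields an extension for \<open>k mod d\<close>, so minimality of
    \<open>d\<close> leaves no positive remainder.\<close>
  have d_dvd: "d dvd k" if k: "k \<in> I" for k
  proof (rule ccontr)
    assume "\<not> d dvd k"
    then have r: "k mod d > 0" using mod_greater_zero_iff_not_dvd by blast
    obtain \<mu> where \<mu>: "ext k \<mu>" using k by (auto simp: I_def)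
    have "c x ^ k / (c x ^ d) ^ (k div d) = c x ^ (k mod d)"
      if x: "x \<in> carrier G" "pi_number \<sigma> (ord x)" for x
    proof -
      have "c x ^ k = (c x ^ d) ^ (k div d) * c x ^ (k mod d)"
        by (simp flip: power_mult power_add)
      then show ?thesis using c_nz[OF x] by simp
    qed
    \<comment> \<open>Division by zero returns zero, so quotients of multiplicative functions are
      multiplicative by algebra alone; the nonvanishing of \<open>c\<close> enters through the power
      computed just before.\<close>
    then have "ext (k mod d) (\<lambda>x. \<mu> x / \<mu>d x ^ (k div d))"
      using \<mu> \<mu>d by (simp add: ext_def power_mult_distrib)
    then have "k mod d \<in> I" by (auto simp: I_def)
    then have "d \<le> k mod d"
      unfolding d_def by (intro Least_le) (use r d_def in auto)
    then show False using d mod_less_divisor[of d k] by linarith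
  qed
  have "d = 1"
  proof (rule ccontr)
    assume "d \<noteq> 1"
    then obtain p where p: "prime p" "p dvd d" using prime_factor_nat by blast
    \<comment> \<open>A prime \<open>p\<close> dividing \<open>d\<close> divides \<open>m\<close>,
      so it lies in \<open>\<sigma>\<close> and a Sylow \<open>p\<close>-subgroup is a
      \<open>\<sigma>\<close>-group. Its index \<open>b\<close> then lies in \<open>I\<close> and is
      divisible by \<open>d\<close>, hence by \<open>p\<close>, which is absurd.\<close>
    have "p \<in> \<sigma>"
      using p dvd_trans[OF _ d_dvd[OF mI], of p] mk(2) by (auto simp: pi_number_def in_prime_factors_iff)
    obtain b where b: "Coset.order G = p ^ multiplicity p (Coset.order G) * b" "\<not> p dvd b"
      by (rule multiplicity_decompose'[of "Coset.order G" p]) (use \<open>Coset.order G > 0\<close> p in auto)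
    obtain P where P: "subgroup P G" "card P = p ^ multiplicity p (Coset.order G)"
      using sylow_thm[OF p(1) is_group b(1) fin] by blast
    have "pi_number \<sigma> p"
      using p(1) \<open>p \<in> \<sigma>\<close> by (simp add: pi_number_def prime_prime_factors prime_gt_0_nat)
    then have "pi_number \<sigma> (p ^ e)" for e
      by (induction e) (simp add: pi_number_def, simp add: pi_number_mult)
    then have "pi_number \<sigma> (card P)" by (simp add: P(2))
    then have "d dvd card (rcosets P)" using d_dvd indexI P by blast
    moreover have "card (rcosets P) = b"
      using lagrange[OF P(1)] P(2) b p by (metis mult.commute mult_left_cancel neq0_conv order_gt_0_iff_finite fin mult_is_0)
    ultimately show False using p b dvd_trans by blast
  qed
  then show ?thesis using \<mu>d by (auto simp: ext_def)
qed

end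

section \<open>Quasi extensions\<close>

lemma linear_characterI:
  assumes G: "group G" and one: "c \<one>\<^bsub>G\<^esub> = 1"
    and mult: "\<And>x y. x \<in> carrier G \<Longrightarrow> y \<in> carrier G \<Longrightarrow> c (x \<otimes>\<^bsub>G\<^esub> y) = c x * c y"
  shows "linear_character G c"
proof -
  have "representation G 1 (\<lambda>x. mat 1 1 (\<lambda>_. c x))"
    by (rule representationI[OF G])
      (auto intro!: eq_matI simp: one mult scalar_prod_def)
  moreover have "affords G (\<lambda>x. mat 1 1 (\<lambda>_. c x)) c"
    by (simp add: affords_def mat_trace_def)
  ultimately show ?thesis
    using one by (auto simp: linear_character_def is_character_def)
qed

text \<open>On the full preimage of a \<open>\<pi>'\<close>-subgroup \<open>K\<close> of the
  quotient, both functions are genuine extensions of \<open>\<theta>\<close>. The last clause makes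
  \<open>l\<close> recoverable from \<open>\<phi>\<close> and \<open>\<phi>'\<close>, so that the
  functions found for different \<open>K\<close> agree where they overlap.\<close>

lemma quasi_extensions_locally_differ_by_linear:
  fixes G (structure)
  assumes G: "group G" and triple: "character_triple G N \<theta>"
    and qe: "quasi_extension G N \<theta> \<pi> \<phi>" "quasi_extension G N \<theta> \<pi> \<phi>'"
    and K: "subgroup K (G Mod N)" "pi_number (compl_primes \<pi>) (card K)"
  shows "\<exists>l. (\<forall>x\<in>\<Union>K. \<forall>y\<in>\<Union>K. l (x \<otimes> y) = l x * l y) \<and> (\<forall>n\<in>N. l n = 1)
    \<and> (\<forall>x\<in>\<Union>K. \<phi>' x = l x * \<phi> x) \<and> (\<forall>x\<in>\<Union>K. \<exists>n\<in>N. \<phi> (n \<otimes> x) \<noteq> 0)"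
proof -
  interpret group G by fact
  have fin: "finite (carrier G)" and "N \<lhd> G" and \<theta>: "irreducible_character (G\<lparr>carrier := N\<rparr>) \<theta>"
    using triple by (auto simp: character_triple_def)
  interpret N: normal N G by fact
  define H where "H = \<Union>K"
  have H: "subgroup H G"
    unfolding H_def by (rule N.factgroup_subgroup_union_subgroup[OF K(1)])
  have NH: "N \<subseteq> H"
    using subgroup.one_closed[OF K(1)] by (auto simp: H_def)
  have "carrier (G\<lparr>carrier := H\<rparr> Mod N) = K"
    using N.factgroup_subgroup_union_factor[OF K(1)] by (simp add: FactGroup_def H_def)
  then have "pi_number (compl_primes \<pi>) (Coset.order (G\<lparr>carrier := H\<rparr> Mod N))"
    using K(2) by (simp add: Coset.order_def)
  then have \<phi>: "is_character (G\<lparr>carrier := H\<rparr>) \<phi>" "\<And>x. x \<in> N \<Longrightarrow> \<phi> x = \<theta> x"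
    and \<phi>': "is_character (G\<lparr>carrier := H\<rparr>) \<phi>'" "\<And>x. x \<in> N \<Longrightarrow> \<phi>' x = \<theta> x"
    using qe H NH unfolding quasi_extension_def by blast+
  have GH: "group (G\<lparr>carrier := H\<rparr>)" using H is_group by (simp add: subgroup.subgroup_is_group)
  have NGH: "N \<lhd> G\<lparr>carrier := H\<rparr>"
    by (rule normal_restrict_supergroup[OF H \<open>N \<lhd> G\<close> NH])
  have finN: "finite N" using fin N.subset finite_subset by blast
  have \<theta>': "irreducible_character ((G\<lparr>carrier := H\<rparr>)\<lparr>carrier := N\<rparr>) \<theta>" using \<theta> by simp
  have "\<exists>n\<in>N. \<phi> (n \<otimes> x) \<noteq> 0" if "x \<in> H" for x
    using extension_not_zero_on_coset[OF GH normal_imp_subgroup[OF NGH] finN \<theta>' \<phi>] that by simp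
  then show ?thesis
    using extensions_differ_by_linear[OF GH NGH finN \<theta>' \<phi> \<phi>'] unfolding H_def by simp
qed

theorem theoremB:
  fixes G :: "('a, 'b) monoid_scheme"
    and N :: "'a set"
    and \<theta> \<phi> \<phi>' :: "'a \<Rightarrow> complex"
    and \<pi> :: "nat set"
  assumes "character_triple G N \<theta>"
    and "\<forall>p\<in>\<pi>. prime p"
    and "normalized_quasi_extension G N \<theta> \<pi> \<phi>"
    and "normalized_quasi_extension G N \<theta> \<pi> \<phi>'"
  shows "\<exists>\<mu>. linear_character (G Mod N) \<mu> \<and>
             (\<forall>x\<in>carrier G. \<phi>' x = \<mu> (N #>\<^bsub>G\<^esub> x) * \<phi> x)"
proof -
  have fin: "finite (carrier G)" and NG: "N \<lhd> G"
    using assms(1) by (auto simp: character_triple_def)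
  have G: "group G" using NG by (simp add: normal_def)
  interpret group G by (rule G)
  interpret N: normal N G by (rule NG)
  interpret Q: group "G Mod N" by (rule N.factorgroup_is_group)
  have qe: "quasi_extension G N \<theta> \<pi> \<phi>" "quasi_extension G N \<theta> \<pi> \<phi>'"
    using assms(3,4) by (auto simp: normalized_quasi_extension_def)
  have finQ: "finite (carrier (G Mod N))" using fin by (simp add: carrier_FactGroup)
  \<comment> \<open>On a coset lying in some \<open>\<pi>'\<close>-subgroup of the quotient this is
    the unique ratio of \<open>\<phi>'\<close> to \<open>\<phi>\<close>; elsewhere it may be an
    arbitrary choice.\<close>
  define c where "c C = (SOME a. \<forall>y\<in>C. \<phi>' y = a * \<phi> y)" for C
  have on_subgroup: "\<exists>l. (\<forall>x\<in>\<Union>K. \<forall>y\<in>\<Union>K. l (x \<otimes>\<^bsub>G\<^esub> y) = l x * l y) \<and> (\<forall>n\<in>N. l n = 1)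
      \<and> (\<forall>x\<in>\<Union>K. \<phi>' x = l x * \<phi> x) \<and> (\<forall>x\<in>\<Union>K. c (N #>\<^bsub>G\<^esub> x) = l x)"
    if K: "subgroup K (G Mod N)" "pi_number (compl_primes \<pi>) (card K)" for K
  proof -
    obtain l where l: "\<forall>x\<in>\<Union>K. \<forall>y\<in>\<Union>K. l (x \<otimes>\<^bsub>G\<^esub> y) = l x * l y" "\<forall>n\<in>N. l n = 1"
      "\<forall>x\<in>\<Union>K. \<phi>' x = l x * \<phi> x" "\<forall>x\<in>\<Union>K. \<exists>n\<in>N. \<phi> (n \<otimes>\<^bsub>G\<^esub> x) \<noteq> 0"
      using quasi_extensions_locally_differ_by_linear[OF G assms(1) qe K] by blast
    have H: "subgroup (\<Union>K) G" by (rule N.factgroup_subgroup_union_subgroup[OF K(1)])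
    have NH: "N \<subseteq> \<Union>K" using subgroup.one_closed[OF K(1)] by auto
    \<comment> \<open>\<open>l\<close> is constant on the coset, being multiplicative and 1 on
      \<open>N\<close>; a point where \<open>\<phi>\<close> does not vanish forces every admissible
      ratio to equal it.\<close>
    have "c (N #>\<^bsub>G\<^esub> x) = l x" if x: "x \<in> \<Union>K" for x
      unfolding c_def
    proof (rule some_equality)
      have eq: "\<phi>' (n \<otimes>\<^bsub>G\<^esub> x) = l x * \<phi> (n \<otimes>\<^bsub>G\<^esub> x)" if "n \<in> N" for n
      proof -
        have "n \<in> \<Union>K" using that NH by blast
        moreover from this have "n \<otimes>\<^bsub>G\<^esub> x \<in> \<Union>K" using subgroup.m_closed[OF H _ x] by blast
        ultimately have "\<phi>' (n \<otimes>\<^bsub>G\<^esub> x) = l (n \<otimes>\<^bsub>G\<^esub> x) * \<phi> (n \<otimes>\<^bsub>G\<^esub> x)"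
          "l (n \<otimes>\<^bsub>G\<^esub> x) = l n * l x"
          using l(1,3) x by blast+
        then show ?thesis using l(2) that by simp
      qed
      then show "\<forall>y\<in>N #>\<^bsub>G\<^esub> x. \<phi>' y = l x * \<phi> y"
        by (auto simp: r_coset_def)
      fix a assume a: "\<forall>y\<in>N #>\<^bsub>G\<^esub> x. \<phi>' y = a * \<phi> y"
      obtain n where n: "n \<in> N" "\<phi> (n \<otimes>\<^bsub>G\<^esub> x) \<noteq> 0" using l(4) x by blast
      have "n \<otimes>\<^bsub>G\<^esub> x \<in> N #>\<^bsub>G\<^esub> x" using n(1) by (auto simp: r_coset_def)
      then show "a = l x" using a eq[OF n(1)] n(2) by auto
    qed
    then show ?thesis using l by blast
  qed
  have c_one: "c \<one>\<^bsub>G Mod N\<^esub> = 1"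
  proof -
    have "subgroup {\<one>\<^bsub>G Mod N\<^esub>} (G Mod N)" by (rule Q.triv_subgroup)
    moreover have "pi_number (compl_primes \<pi>) (card {\<one>\<^bsub>G Mod N\<^esub>})" by (simp add: pi_number_def)
    ultimately obtain l where "\<forall>n\<in>N. l n = 1" "\<forall>x\<in>N. c (N #>\<^bsub>G\<^esub> x) = l x"
      using on_subgroup[of "{\<one>\<^bsub>G Mod N\<^esub>}"] by auto
    then have "c (N #>\<^bsub>G\<^esub> \<one>\<^bsub>G\<^esub>) = 1" using N.one_closed by simp
    then show ?thesis by (simp add: N.subset)
  qed
  \<comment> \<open>Conjugate cosets admit the same scalars, because \<open>\<phi>\<close> and
    \<open>\<phi>'\<close> are class functions. The choice operator therefore returns the same
    value, even on cosets where the ratio is not unique.\<close>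
  have c_conj: "c (g \<otimes>\<^bsub>G Mod N\<^esub> C \<otimes>\<^bsub>G Mod N\<^esub> inv\<^bsub>G Mod N\<^esub> g) = c C"
    if gC: "g \<in> carrier (G Mod N)" "C \<in> carrier (G Mod N)" for g C
  proof -
    obtain a b where ab: "a \<in> carrier G" "b \<in> carrier G" "g = N #>\<^bsub>G\<^esub> a" "C = N #>\<^bsub>G\<^esub> b"
      using gC by (auto simp: carrier_FactGroup)
    \<comment> \<open>Stated for all \<open>a\<close> and \<open>b\<close>, so that a second use
      with \<open>inv a\<close> gives the converse implication.\<close>
    have conj: "\<forall>z\<in>N #>\<^bsub>G\<^esub> (a \<otimes>\<^bsub>G\<^esub> b \<otimes>\<^bsub>G\<^esub> inv\<^bsub>G\<^esub> a). \<phi>' z = e * \<phi> z"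
      if e: "\<forall>z\<in>N #>\<^bsub>G\<^esub> b. \<phi>' z = e * \<phi> z" and ab: "a \<in> carrier G" "b \<in> carrier G" for a b e
    proof
      fix z assume "z \<in> N #>\<^bsub>G\<^esub> (a \<otimes>\<^bsub>G\<^esub> b \<otimes>\<^bsub>G\<^esub> inv\<^bsub>G\<^esub> a)"
      then obtain n where n: "n \<in> N" "z = n \<otimes>\<^bsub>G\<^esub> (a \<otimes>\<^bsub>G\<^esub> b \<otimes>\<^bsub>G\<^esub> inv\<^bsub>G\<^esub> a)"
        by (auto simp: r_coset_def)
      define y where "y = inv\<^bsub>G\<^esub> a \<otimes>\<^bsub>G\<^esub> n \<otimes>\<^bsub>G\<^esub> a \<otimes>\<^bsub>G\<^esub> b"
      have "inv\<^bsub>G\<^esub> a \<otimes>\<^bsub>G\<^esub> n \<otimes>\<^bsub>G\<^esub> a \<in> N" using N.inv_op_closed1 ab n by blast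
      then have "y \<in> N #>\<^bsub>G\<^esub> b" by (auto simp: y_def r_coset_def)
      moreover have "z = a \<otimes>\<^bsub>G\<^esub> y \<otimes>\<^bsub>G\<^esub> inv\<^bsub>G\<^esub> a"
        using ab n by (simp add: y_def m_assoc mult_inv_cancel)
      moreover have "y \<in> carrier G" using ab n by (simp add: y_def)
      ultimately show "\<phi>' z = e * \<phi> z"
        using qe ab e by (simp add: quasi_extension_def class_function_def)
    qed
    have "inv\<^bsub>G\<^esub> a \<otimes>\<^bsub>G\<^esub> (a \<otimes>\<^bsub>G\<^esub> b \<otimes>\<^bsub>G\<^esub> inv\<^bsub>G\<^esub> a) \<otimes>\<^bsub>G\<^esub> inv\<^bsub>G\<^esub> (inv\<^bsub>G\<^esub> a) = b"
      using ab by (simp add: m_assoc inv_mult_cancel)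
    then have "(\<forall>z\<in>N #>\<^bsub>G\<^esub> (a \<otimes>\<^bsub>G\<^esub> b \<otimes>\<^bsub>G\<^esub> inv\<^bsub>G\<^esub> a). \<phi>' z = e * \<phi> z)
        \<longleftrightarrow> (\<forall>z\<in>N #>\<^bsub>G\<^esub> b. \<phi>' z = e * \<phi> z)" for e
      using conj[of b e a] conj[of "a \<otimes>\<^bsub>G\<^esub> b \<otimes>\<^bsub>G\<^esub> inv\<^bsub>G\<^esub> a" e "inv\<^bsub>G\<^esub> a"] ab(1,2)
      by (metis inv_closed m_closed)
    moreover have "g \<otimes>\<^bsub>G Mod N\<^esub> C \<otimes>\<^bsub>G Mod N\<^esub> inv\<^bsub>G Mod N\<^esub> g
        = N #>\<^bsub>G\<^esub> (a \<otimes>\<^bsub>G\<^esub> b \<otimes>\<^bsub>G\<^esub> inv\<^bsub>G\<^esub> a)"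
      using ab gC(1) by (simp add: N.inv_FactGroup N.rcos_inv N.rcos_sum)
    ultimately show ?thesis by (simp add: c_def ab(4))
  qed
  have c_mult: "c (C \<otimes>\<^bsub>G Mod N\<^esub> D) = c C * c D"
    if K: "subgroup K (G Mod N)" "pi_number (compl_primes \<pi>) (card K)" and CD: "C \<in> K" "D \<in> K"
    for K C D
  proof -
    obtain l where l: "\<forall>x\<in>\<Union>K. \<forall>y\<in>\<Union>K. l (x \<otimes>\<^bsub>G\<^esub> y) = l x * l y"
      "\<forall>x\<in>\<Union>K. c (N #>\<^bsub>G\<^esub> x) = l x"
      using on_subgroup[OF K] by blast
    have "C \<in> carrier (G Mod N)" "D \<in> carrier (G Mod N)"
      using CD subgroup.subset[OF K(1)] by auto
    then obtain a b where ab: "a \<in> carrier G" "b \<in> carrier G" "C = N #>\<^bsub>G\<^esub> a" "D = N #>\<^bsub>G\<^esub> b"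
      by (auto simp: carrier_FactGroup)
    have "a \<in> \<Union>K" "b \<in> \<Union>K"
      using CD ab rcos_self[OF _ N.subgroup_axioms] by blast+
    moreover from this have "a \<otimes>\<^bsub>G\<^esub> b \<in> \<Union>K"
      using subgroup.m_closed[OF N.factgroup_subgroup_union_subgroup[OF K(1)]] by blast
    ultimately have "c (N #>\<^bsub>G\<^esub> (a \<otimes>\<^bsub>G\<^esub> b)) = l (a \<otimes>\<^bsub>G\<^esub> b)" "l (a \<otimes>\<^bsub>G\<^esub> b) = l a * l b"
      "c (N #>\<^bsub>G\<^esub> a) = l a" "c (N #>\<^bsub>G\<^esub> b) = l b"
      using l by blast+
    then show ?thesis using ab by (simp add: N.rcos_sum)
  qed
  have "\<exists>\<mu>. \<mu> \<one>\<^bsub>G Mod N\<^esub> = 1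
    \<and> (\<forall>C\<in>carrier (G Mod N). \<forall>D\<in>carrier (G Mod N). \<mu> (C \<otimes>\<^bsub>G Mod N\<^esub> D) = \<mu> C * \<mu> D)
    \<and> (\<forall>C\<in>carrier (G Mod N). pi_number (compl_primes \<pi>) (Q.ord C) \<longrightarrow> \<mu> C = c C)"
    by (rule Q.extend_linear_from_pi_subgroups[where c = c and \<sigma> = "compl_primes \<pi>", OF finQ c_one c_conj c_mult])
  then obtain \<mu> where \<mu>: "\<mu> \<one>\<^bsub>G Mod N\<^esub> = 1"
    "\<forall>C\<in>carrier (G Mod N). \<forall>D\<in>carrier (G Mod N). \<mu> (C \<otimes>\<^bsub>G Mod N\<^esub> D) = \<mu> C * \<mu> D"
    "\<forall>C\<in>carrier (G Mod N). pi_number (compl_primes \<pi>) (Q.ord C) \<longrightarrow> \<mu> C = c C"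
    by blast
  have "\<phi>' x = \<mu> (N #>\<^bsub>G\<^esub> x) * \<phi> x" if x: "x \<in> carrier G" for x
  proof (cases "pi_part G \<pi> x \<in> N")
    case False
    then show ?thesis
      using assms(3,4) x by (simp add: normalized_quasi_extension_def)
  next
    case True
    define y where "y = pi_part G \<pi> x"
    have "is_pi_part G \<pi> x y"
      unfolding y_def pi_part_def by (rule theI'[OF ex1_pi_part[OF fin x]])
    then obtain z where z: "z \<in> carrier G" "x = y \<otimes>\<^bsub>G\<^esub> z" "pi_number (compl_primes \<pi>) (ord z)"
      using x by (auto simp: is_pi_part_def)
    have yN: "y \<in> N" using True by (simp add: y_def)
    \<comment> \<open>As the \<open>\<pi>\<close>-part \<open>y\<close> lies in \<open>N\<close>,
      the coset of \<open>x\<close> is that of its \<open>\<pi>'\<close>-part \<open>z\<close>, so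
      its order in the quotient is a \<open>\<pi>'\<close>-number.\<close>
    have "N #>\<^bsub>G\<^esub> x = N #>\<^bsub>G\<^esub> y #>\<^bsub>G\<^esub> z"
      unfolding z(2) by (rule coset_mult_assoc[symmetric]) (use yN z(1) N.subset in auto)
    then have "N #>\<^bsub>G\<^esub> x = N #>\<^bsub>G\<^esub> z" by (simp add: N.rcos_const yN)
    then have "(N #>\<^bsub>G\<^esub> x) [^]\<^bsub>G Mod N\<^esub> ord z = \<one>\<^bsub>G Mod N\<^esub>"
      using N.FactGroup_pow[OF z(1)] z(1) N.subset by simp
    moreover have xQ: "N #>\<^bsub>G\<^esub> x \<in> carrier (G Mod N)" using x by (auto simp: carrier_FactGroup)
    ultimately have ord: "pi_number (compl_primes \<pi>) (Q.ord (N #>\<^bsub>G\<^esub> x))"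
      using Q.pow_eq_id pi_number_dvd[OF z(3)] by blast
    \<comment> \<open>On the cyclic \<open>\<pi>'\<close>-subgroup generated by the coset of
      \<open>x\<close>, the ratio of \<open>\<phi>'\<close> to \<open>\<phi>\<close> is
      \<open>c\<close>, which agrees with \<open>\<mu>\<close> at this coset.\<close>
    define K where "K = generate (G Mod N) {N #>\<^bsub>G\<^esub> x}"
    have K: "subgroup K (G Mod N)" "pi_number (compl_primes \<pi>) (card K)"
      using Q.generate_is_subgroup[of "{N #>\<^bsub>G\<^esub> x}"] Q.generate_pow_card[OF xQ] xQ ord
      by (simp_all add: K_def)
    have "N #>\<^bsub>G\<^esub> x \<in> K" by (simp add: K_def generate.incl)
    then have "x \<in> \<Union>K" using rcos_self[OF x N.subgroup_axioms] by blast
    then have "\<phi>' x = c (N #>\<^bsub>G\<^esub> x) * \<phi> x" using on_subgroup[OF K] by auto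
    then show ?thesis using \<mu>(3) xQ ord by simp
  qed
  moreover have "linear_character (G Mod N) \<mu>"
    by (rule linear_characterI[where c = \<mu>, OF Q.is_group \<mu>(1)]) (use \<mu>(2) in blast)
  ultimately show ?thesis by blast
qed

end
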